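(* Let $A$ and $B$ be polynomials with complex coefficients of degree at least two. Then the conditions $A\leq B$ and $B\leq A$ hold simultaneously if and only if $A\sim B$. Furthermore, $A\sim B$ if and only if there exist polynomials $X,Y$ such that $$B\circ Y=Y\circ A,\qquad A\circ X=X\circ B,$$ and $Y\circ X=B^{\circ d}$ for some integer $d\geq 0$.
   Context: For polynomials $A,B$ of degree at least two, $A\leq B$ means that there exists a non-constant polynomial $X$ with $A\circ X=X\circ B$. The relation $F\sim G$ means that there exist $n\ge 1$ and polynomials $A_i,B_i$, $1\le i\le n$, such that $F=A_1\circ B_1$, $G=B_n\circ A_n$, and $B_i\circ A_i=A_{i+1}\circ B_{i+1}$ for $1\le i\le n-1$. $B^{\circ d}$ denotes the $d$-th iterate of $B$, with $B^{\circ 0}=z$. *)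

theory Defs
  imports Complex_Main "HOL-Computational_Algebra.Computational_Algebra"
begin

text \<open>Used for polynomials of degree at least two; \<open>X\<close> itself may have degree one.\<close>

definition semiconj_le :: "complex poly \<Rightarrow> complex poly \<Rightarrow> bool"  (infix "\<preceq>\<^sub>s" 50) where
  "A \<preceq>\<^sub>s B \<longleftrightarrow> (\<exists>X. degree X > 0 \<and> A \<circ>\<^sub>p X = X \<circ>\<^sub>p B)"

text \<open>
  The polynomials \<open>A\<^sub>1, \<dots>, A\<^sub>n\<close> and \<open>B\<^sub>1, \<dots>, B\<^sub>n\<close> are the values at \<open>1, \<dots>, n\<close> of functions on
  the natural numbers; values outside this range are irrelevant.  Factors of degree one are allowed.
\<close>

definition decomp_equiv :: "complex poly \<Rightarrow> complex poly \<Rightarrow> bool"  (infix "\<sim>\<^sub>d" 50) where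
  "F \<sim>\<^sub>d G \<longleftrightarrow>
     (\<exists>n\<ge>1. \<exists>A B :: nat \<Rightarrow> complex poly.
        F = A 1 \<circ>\<^sub>p B 1 \<and>
        G = B n \<circ>\<^sub>p A n \<and>
        (\<forall>i. 1 \<le> i \<and> i \<le> n - 1 \<longrightarrow> B i \<circ>\<^sub>p A i = A (i + 1) \<circ>\<^sub>p B (i + 1)))"

definition poly_iterate :: "complex poly \<Rightarrow> nat \<Rightarrow> complex poly" where
  "poly_iterate B d = ((\<lambda>P. B \<circ>\<^sub>p P) ^^ d) [:0, 1:]"

end

theory Submission
  imports Defs "HOL-Complex_Analysis.Complex_Analysis" "HOL-Number_Theory.Cong"
begin

text \<open>
  A chain witnessing \<open>A \<sim> B\<close> is a sequence of swaps \<open>U \<circ> V \<mapsto> V \<circ> U\<close>.  A swap is a semiconjugacy in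
  both directions, by \<open>U\<close> and by \<open>V\<close>.  Along a chain the factors \<open>U\<close> compose to \<open>X\<close>, the factors
  \<open>V\<close> compose to \<open>Y\<close>, and \<open>Y \<circ> X\<close> collapses to the iterate of \<open>B\<close> whose exponent is the length of
  the chain (\<open>swap_chain_imp_intertwiners\<close>).  Since such \<open>X\<close> and \<open>Y\<close> are nonconstant, only one
  implication is hard: mutual semiconjugacy implies the existence of a chain.

  Let \<open>A \<circ> X = X \<circ> B\<close> and \<open>B \<circ> Y = Y \<circ> A\<close>.  If \<open>deg A\<close> and \<open>deg X\<close> have a common factor greater
  than one, Engstrom's theorem (\<open>common_left_factor\<close>) yields \<open>A = U \<circ> P\<close> and \<open>X = U \<circ> Q\<close> with \<open>P \<circ> X = Q \<circ> B\<close>, so the swap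
  \<open>A \<mapsto> P \<circ> U\<close> replaces \<open>X\<close> by the polynomial \<open>Q\<close> of smaller degree.  Iterating, \<open>deg X\<close> becomes
  coprime to \<open>deg A\<close> (\<open>strip_to_coprime_degree\<close>).  If the remaining \<open>X\<close> is linear, it conjugates the
  two maps, and a linear conjugation is itself a swap.

  Otherwise \<open>X \<circ> Y\<close> commutes with \<open>A\<close> and its degree has a divisor \<open>r \<ge> 2\<close> coprime to \<open>deg A\<close>.  The
  same reduction, applied to a high iterate of \<open>X \<circ> Y\<close>, produces \<open>A' \<sim> A\<close> and \<open>A' \<circ> Z = Z \<circ> A\<close> with
  \<open>deg Z\<close> coprime to \<open>deg A\<close> and as large as desired.  When the degrees are coprime, the map
  \<open>z \<mapsto> (Z z, A z)\<close> is injective on the fibre of \<open>A\<close> over a point where \<open>Z\<close> is unramified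
  (\<open>fibre_injective\<close>).  Hence the ramification of \<open>A'\<close> over \<open>v\<close> reappears, for \<open>A\<close>, over every
  unramified preimage of \<open>v\<close> under \<open>Z\<close>.  As the total ramification is bounded by the degree, \<open>Z\<close> is
  ramified to about half of its degree over each critical value of \<open>A' \<circ> A'\<close>, so there are at most
  two such values.  One value forces a power map; with two of them, all ramification is of index two
  and \<open>A'\<close> satisfies the Chebyshev differential equation
  (\<open>coprime_semiconjugacy_dichotomy\<close>, \<open>chebyshev_equation_of_simple_points\<close>).

  The same holds for \<open>B\<close>, which leaves a comparison of two special maps that are semiconjugate in
  both directions.  A totally invariant point is inherited through a semiconjugacy, and two power maps
  of equal degree are conjugate.  Two Chebyshev solutions of equal degree agree up to sign; for even
  degree the sign is a conjugation by \<open>-z\<close>, and for odd degree the wrong sign contradicts one of the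
  two semiconjugacies (\<open>no_semiconjugacy_to_negated_chebyshev\<close>).
\<close>

section \<open>Swapping the factors of a decomposition\<close>

definition swap :: "complex poly \<Rightarrow> complex poly \<Rightarrow> bool" where
  "swap F G \<longleftrightarrow> (\<exists>U V. F = U \<circ>\<^sub>p V \<and> G = V \<circ>\<^sub>p U)"

lemma swap_sym: "swap F G \<Longrightarrow> swap G F"
  by (auto simp: swap_def)

text \<open>Indexed families of factors are awkward to concatenate and to reverse; as a reflexive transitive
  closure the relation is visibly an equivalence and supports induction.  The closure may be taken
  reflexive because \<open>A = A \<circ> id\<close> is a decomposition.\<close>

lemma decomp_equiv_iff_swap_chain: "F \<sim>\<^sub>d G \<longleftrightarrow> swap\<^sup>*\<^sup>* F G"
proof
  assume "F \<sim>\<^sub>d G"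
  then obtain n :: nat and A B where n: "n \<ge> 1" and F: "F = A 1 \<circ>\<^sub>p B 1" and G: "G = B n \<circ>\<^sub>p A n"
    and step: "\<forall>i. 1 \<le> i \<and> i \<le> n - 1 \<longrightarrow> B i \<circ>\<^sub>p A i = A (i + 1) \<circ>\<^sub>p B (i + 1)"
    unfolding decomp_equiv_def by blast
  have "swap\<^sup>*\<^sup>* F (B k \<circ>\<^sub>p A k)" if "k \<ge> 1" "k \<le> n" for k
    using that
  proof (induction k rule: nat_induct_at_least)
    case base
    show ?case unfolding F by (rule r_into_rtranclp) (auto simp: swap_def)
  next
    case (Suc k)
    have "swap (B k \<circ>\<^sub>p A k) (B (Suc k) \<circ>\<^sub>p A (Suc k))"
      using step[rule_format, of k] Suc by (auto simp: swap_def)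
    with Suc show ?case by (auto intro: rtranclp.rtrancl_into_rtrancl)
  qed
  with n show "swap\<^sup>*\<^sup>* F G" by (simp add: G)
next
  assume "swap\<^sup>*\<^sup>* F G"
  then show "F \<sim>\<^sub>d G"
  proof (induction rule: rtranclp_induct)
    case base
    show ?case unfolding decomp_equiv_def
      by (rule exI[of _ 1], simp, rule exI[of _ "\<lambda>_. F"], rule exI[of _ "\<lambda>_. [:0, 1:]"]) (simp add: pcompose_pCons)
  next
    case (step G H)
    then obtain n :: nat and A B where n: "n \<ge> 1" and F: "F = A 1 \<circ>\<^sub>p B 1" and G: "G = B n \<circ>\<^sub>p A n"
      and chain: "\<forall>i. 1 \<le> i \<and> i \<le> n - 1 \<longrightarrow> B i \<circ>\<^sub>p A i = A (i + 1) \<circ>\<^sub>p B (i + 1)"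
      unfolding decomp_equiv_def by blast
    from step obtain U V where UV: "G = U \<circ>\<^sub>p V" "H = V \<circ>\<^sub>p U" by (auto simp: swap_def)
    define A' B' where "A' = A(n + 1 := U)" and "B' = B(n + 1 := V)"
    have "B' i \<circ>\<^sub>p A' i = A' (i + 1) \<circ>\<^sub>p B' (i + 1)" if "1 \<le> i" "i \<le> n" for i
      using chain[rule_format, of i] that UV G by (cases "i = n") (auto simp: A'_def B'_def)
    then show ?case unfolding decomp_equiv_def
      using n F UV by (intro exI[of _ "n + 1"] conjI exI[of _ A'] exI[of _ B'])
        (auto simp: A'_def B'_def)
  qed
qed

lemma poly_iterate_0 [simp]: "poly_iterate B 0 = [:0, 1:]"
  and poly_iterate_Suc [simp]: "poly_iterate B (Suc d) = B \<circ>\<^sub>p poly_iterate B d"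
  by (simp_all add: poly_iterate_def)

lemma degree_poly_iterate: "degree (poly_iterate B d) = degree B ^ d"
  by (induction d) (auto simp: degree_pcompose)

lemma poly_iterate_intertwine:
  assumes "A \<circ>\<^sub>p X = X \<circ>\<^sub>p B"
  shows "poly_iterate A d \<circ>\<^sub>p X = X \<circ>\<^sub>p poly_iterate B d"
  using assms by (induction d) (simp_all add: pcompose_pCons pcompose_assoc flip: pcompose_assoc[of A])

text \<open>Appending a swap \<open>U \<circ> V \<mapsto> V \<circ> U\<close> replaces \<open>X\<close> by \<open>X \<circ> U\<close> and \<open>Y\<close> by \<open>V \<circ> Y\<close>.  In
  \<open>V \<circ> Y \<circ> X \<circ> U\<close> the inner product is an iterate of \<open>U \<circ> V\<close>, and moving \<open>V\<close> past it turns the whole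
  into one more iterate of \<open>V \<circ> U\<close>.\<close>

lemma swap_chain_imp_intertwiners:
  assumes "swap\<^sup>*\<^sup>* A B"
  shows "\<exists>X Y d. B \<circ>\<^sub>p Y = Y \<circ>\<^sub>p A \<and> A \<circ>\<^sub>p X = X \<circ>\<^sub>p B \<and> Y \<circ>\<^sub>p X = poly_iterate B d"
  using assms
proof (induction rule: rtranclp_induct)
  case base
  show ?case
    by (intro exI[of _ "[:0, 1:]"] exI[of _ 0]) (simp add: pcompose_pCons)
next
  case (step G H)
  then obtain X Y d where XY: "G \<circ>\<^sub>p Y = Y \<circ>\<^sub>p A" "A \<circ>\<^sub>p X = X \<circ>\<^sub>p G" "Y \<circ>\<^sub>p X = poly_iterate G d"
    by blast
  from step obtain U V where UV: "G = U \<circ>\<^sub>p V" "H = V \<circ>\<^sub>p U" by (auto simp: swap_def)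
  have HV: "H \<circ>\<^sub>p V = V \<circ>\<^sub>p G" and GU: "G \<circ>\<^sub>p U = U \<circ>\<^sub>p H"
    by (simp_all add: UV pcompose_assoc)
  have "H \<circ>\<^sub>p (V \<circ>\<^sub>p Y) = (V \<circ>\<^sub>p Y) \<circ>\<^sub>p A"
    by (metis HV XY(1) pcompose_assoc)
  moreover have "A \<circ>\<^sub>p (X \<circ>\<^sub>p U) = (X \<circ>\<^sub>p U) \<circ>\<^sub>p H"
    by (metis GU XY(2) pcompose_assoc)
  moreover have "(V \<circ>\<^sub>p Y) \<circ>\<^sub>p (X \<circ>\<^sub>p U) = poly_iterate H (Suc d)"
  proof -
    have "(V \<circ>\<^sub>p Y) \<circ>\<^sub>p (X \<circ>\<^sub>p U) = (V \<circ>\<^sub>p poly_iterate G d) \<circ>\<^sub>p U"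
      by (metis XY(3) pcompose_assoc)
    also have "\<dots> = poly_iterate H d \<circ>\<^sub>p H"
      by (metis HV UV(2) pcompose_assoc poly_iterate_intertwine)
    also have "\<dots> = H \<circ>\<^sub>p poly_iterate H d"
      by (metis poly_iterate_intertwine)
    finally show ?thesis by simp
  qed
  ultimately show ?case by blast
qed

lemma semiconj_le_trans: "A \<preceq>\<^sub>s B \<Longrightarrow> B \<preceq>\<^sub>s C \<Longrightarrow> A \<preceq>\<^sub>s C"
  unfolding semiconj_le_def
proof (elim exE conjE)
  fix X Y assume "degree X > 0" "A \<circ>\<^sub>p X = X \<circ>\<^sub>p B" "degree Y > 0" "B \<circ>\<^sub>p Y = Y \<circ>\<^sub>p C"
  then show "\<exists>X. degree X > 0 \<and> A \<circ>\<^sub>p X = X \<circ>\<^sub>p C"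
    by (intro exI[of _ "X \<circ>\<^sub>p Y"]) (auto simp: degree_pcompose, metis pcompose_assoc)
qed

lemma intertwiners_imp_semiconj_le:
  assumes "degree B > 0" "B \<circ>\<^sub>p Y = Y \<circ>\<^sub>p A" "A \<circ>\<^sub>p X = X \<circ>\<^sub>p B" "Y \<circ>\<^sub>p X = poly_iterate B d"
  shows "A \<preceq>\<^sub>s B \<and> B \<preceq>\<^sub>s A"
proof -
  have "degree Y * degree X = degree B ^ d"
    using assms(4) by (metis degree_pcompose degree_poly_iterate)
  with assms(1) have "degree X > 0" "degree Y > 0"
    by (metis gr0I mult_is_0 nat_zero_less_power_iff)+
  with assms show ?thesis by (auto simp: semiconj_le_def)
qed

lemma swap_chain_imp_semiconj_le:
  "swap\<^sup>*\<^sup>* A B \<Longrightarrow> degree B > 0 \<Longrightarrow> A \<preceq>\<^sub>s B \<and> B \<preceq>\<^sub>s A"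
  using swap_chain_imp_intertwiners intertwiners_imp_semiconj_le by blast

lemma semiconj_le_degree_eq: "A \<preceq>\<^sub>s B \<Longrightarrow> degree A = degree B"
  unfolding semiconj_le_def by (metis degree_pcompose mult.commute mult_cancel2 not_gr_zero)

lemma swap_degree_eq: "swap A B \<Longrightarrow> degree A = degree B"
  by (auto simp: swap_def degree_pcompose mult.commute)

lemma swap_chain_degree_eq: "swap\<^sup>*\<^sup>* A B \<Longrightarrow> degree A = degree B"
  by (induction rule: rtranclp_induct) (auto dest: swap_degree_eq)

lemma swap_chain_sym: "swap\<^sup>*\<^sup>* A B \<Longrightarrow> swap\<^sup>*\<^sup>* B A"
  by (metis swap_sym sympD sympI symp_rtranclp)

lemma linear_poly_inverse:
  assumes "degree (L :: complex poly) = 1"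
  obtains M where "degree M = 1" "L \<circ>\<^sub>p M = [:0, 1:]" "M \<circ>\<^sub>p L = [:0, 1:]"
proof -
  obtain a b where L: "L = [:b, a:]" "a \<noteq> 0"
    using assms by (metis degree1_coeffs)
  show ?thesis
    by (rule that[of "[:-b/a, 1/a:]"]) (use L in \<open>auto simp: pcompose_pCons\<close>)
qed

lemma linear_conjugate_imp_swap:
  assumes "degree (L :: complex poly) = 1" "A \<circ>\<^sub>p L = L \<circ>\<^sub>p B"
  shows "swap A B"
proof -
  obtain M where M: "L \<circ>\<^sub>p M = [:0, 1:]" "M \<circ>\<^sub>p L = [:0, 1:]"
    using linear_poly_inverse[OF assms(1)] by blast
  have "A = L \<circ>\<^sub>p (B \<circ>\<^sub>p M)"
    by (metis M(1) assms(2) pcompose_assoc pcompose_idR)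
  moreover have "(B \<circ>\<^sub>p M) \<circ>\<^sub>p L = B"
    by (metis M(2) pcompose_assoc pcompose_idR)
  ultimately show ?thesis unfolding swap_def by metis
qed

section \<open>Approximate roots and common left factors\<close>

lemma pcompose_right_cancel:
  fixes P Q :: "complex poly"
  assumes "P \<circ>\<^sub>p X = Q \<circ>\<^sub>p X" "degree X > 0"
  shows "P = Q"
  using pcompose_eq_0[of "P - Q" X] assms by (simp add: pcompose_diff)

text \<open>With equal leading coefficients no cancellation can occur at the top of \<open>\<Sum>\<^sub>i Q\<^bsup>d-1-i\<^esup> P\<^bsup>i\<^esup>\<close>:
  all \<open>d\<close> summands have the same leading coefficient.  So a small difference of \<open>d\<close>-th powers forces
  a small difference of the bases.\<close>

lemma power_diff_eq_cofactor:
  fixes P Q :: "complex poly"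
  assumes "degree P = e" "degree Q = e" "lead_coeff P = a" "lead_coeff Q = a" "a \<noteq> 0" "d > 0"
  obtains S where "P ^ d - Q ^ d = (P - Q) * S" "degree S = (d - 1) * e"
    "lead_coeff S = of_nat d * a ^ (d - 1)"
proof -
  define S where "S = (\<Sum>i<d. Q ^ (d - Suc i) * P ^ i)"
  have le: "degree (Q ^ (d - Suc i) * P ^ i) \<le> (d - 1) * e" if "i < d" for i
  proof -
    have "degree (Q ^ (d - Suc i) * P ^ i) \<le> e * (d - Suc i) + e * i"
      using degree_mult_le[of "Q ^ (d - Suc i)" "P ^ i"] degree_power_le[of Q "d - Suc i"]
        degree_power_le[of P i] assms by simp
    also have "\<dots> = (d - 1) * e"
      using that by (simp add: mult.commute flip: distrib_left)
    finally show ?thesis .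
  qed
  have co: "coeff (Q ^ (d - Suc i) * P ^ i) ((d - 1) * e) = a ^ (d - 1)" if "i < d" for i
  proof -
    have "P \<noteq> 0" "Q \<noteq> 0" using assms by auto
    then have "degree (Q ^ (d - Suc i) * P ^ i) = (d - Suc i) * e + i * e"
      using assms by (simp add: degree_mult_eq degree_power_eq)
    also have "\<dots> = (d - 1) * e"
      using that by (simp flip: add_mult_distrib)
    finally have "coeff (Q ^ (d - Suc i) * P ^ i) ((d - 1) * e) = lead_coeff (Q ^ (d - Suc i) * P ^ i)"
      by simp
    also have "\<dots> = a ^ (d - 1)"
      using assms that by (simp add: lead_coeff_mult lead_coeff_power flip: power_add)
    finally show ?thesis .
  qed
  have "coeff S ((d - 1) * e) = (\<Sum>i<d. a ^ (d - 1))"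
    unfolding S_def coeff_sum by (rule sum.cong) (use co in auto)
  then have cS: "coeff S ((d - 1) * e) = of_nat d * a ^ (d - 1)" by simp
  have "degree S \<le> (d - 1) * e"
    unfolding S_def by (rule degree_sum_le) (use le in auto)
  moreover have "of_nat d * a ^ (d - 1) \<noteq> 0" using assms by simp
  ultimately have "degree S = (d - 1) * e"
    using cS le_degree[of S] by (metis le_antisym)
  moreover have "P ^ d - Q ^ d = (P - Q) * S"
    unfolding S_def by (rule power_diff_sumr2)
  ultimately show ?thesis using that cS by metis
qed

text \<open>A nonzero \<open>P - Q\<close> would make \<open>P\<^bsup>d\<^esup> - Q\<^bsup>d\<^esup>\<close> at least as large as the cofactor, of degree \<open>(d - 1) e\<close>.\<close>

lemma approximate_root_unique:
  fixes P Q :: "complex poly"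
  assumes "degree P = e" "degree Q = e" "lead_coeff P = lead_coeff Q" "P \<noteq> 0" "d > 0"
    and "P ^ d = Q ^ d \<or> degree (P ^ d - Q ^ d) < (d - 1) * e"
  shows "P = Q"
proof (rule ccontr)
  assume "P \<noteq> Q"
  obtain S where S: "P ^ d - Q ^ d = (P - Q) * S" "degree S = (d - 1) * e"
    "lead_coeff S = of_nat d * lead_coeff P ^ (d - 1)"
    using power_diff_eq_cofactor[of P e Q "lead_coeff P" d] assms by (metis leading_coeff_0_iff)
  have "S \<noteq> 0" using S(3) assms(4,5) by (auto simp: )
  with \<open>P \<noteq> Q\<close> have "(P - Q) * S \<noteq> 0" "degree ((P - Q) * S) \<ge> (d - 1) * e"
    using S(2) by (auto simp: degree_mult_eq)
  with assms(6) S(1) show False by auto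
qed

text \<open>The \<open>d\<close>-th root of \<open>A\<close> as a series at infinity, cut off to its polynomial part.  Its coefficients
  are found one by one: the \<open>e\<close> top coefficients of the error can be removed in turn by the
  \<open>e\<close> lower coefficients of \<open>P\<close>, and each of these enters linearly.\<close>

lemma approximate_root_exists:
  fixes A :: "complex poly"
  assumes "degree A = d * e" "d > 0" "a ^ d = lead_coeff A" "A \<noteq> 0"
  obtains P where "degree P = e" "lead_coeff P = a"
    "A = P ^ d \<or> degree (A - P ^ d) < (d - 1) * e"
proof -
  have a: "a \<noteq> 0"
    using assms by (metis leading_coeff_0_iff power_0_left less_irrefl)
  have "\<exists>P. degree P = e \<and> lead_coeff P = a \<and> (A = P ^ d \<or> degree (A - P ^ d) < (d - 1) * e + k)"
    if "k \<le> e" for k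
    using that
  proof (induction "e - k" arbitrary: k)
    case 0
    then have k: "k = e" by simp
    define P where "P = monom a e"
    have P: "degree P = e" "lead_coeff P = a"
      using a by (auto simp: P_def degree_monom_eq)
    have "A = P ^ d \<or> degree (A - P ^ d) < d * e"
    proof (cases "d * e = 0")
      case True
      then have "e = 0" using assms by simp
      then have "degree A = 0" "P ^ d = [:a ^ d:]"
        using assms by (auto simp: P_def monom_0 poly_const_pow)
      then have "A = P ^ d" using assms(3) by (auto elim!: degree_eq_zeroE)
      then show ?thesis ..
    next
      case False
      have "coeff (P ^ d) (d * e) = a ^ d"
        using P a by (metis degree_power_eq lead_coeff_power leading_coeff_0_iff mult.commute)
      moreover have "degree (P ^ d) \<le> d * e"
        using P degree_power_le[of P d] by (simp add: mult.commute)
      ultimately have "degree (A - P ^ d) \<le> d * e" "coeff (A - P ^ d) (d * e) = 0"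
        using assms by (auto intro: degree_diff_le)
      then show ?thesis using False
        by (metis le_neq_implies_less leading_coeff_0_iff right_minus_eq)
    qed
    moreover have "d * e = (d - 1) * e + e"
      using assms(2) by (cases d) auto
    ultimately show ?case using P k by auto
  next
    case (Suc x)
    then have "k < e" by linarith
    from Suc(1)[of "Suc k"] Suc(2,3)
    obtain P where P: "degree P = e" "lead_coeff P = a"
      "A = P ^ d \<or> degree (A - P ^ d) < (d - 1) * e + Suc k" by force
    show ?case
    proof (cases "A = P ^ d \<or> degree (A - P ^ d) < (d - 1) * e + k")
      case True
      with P show ?thesis by auto
    next
      case False
      define R where "R = A - P ^ d"
      have R: "degree R = (d - 1) * e + k" "R \<noteq> 0"
        using P False by (auto simp: R_def)
      define c where "c = lead_coeff R / (of_nat d * a ^ (d - 1))"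
      have c: "c \<noteq> 0" "c * (of_nat d * a ^ (d - 1)) = lead_coeff R"
        using R(2) a assms(2) by (simp_all add: c_def)
      \<comment> \<open>One correction term of degree \<open>k < e\<close> kills the leading coefficient of the error.\<close>
      define M where "M = monom c k"
      have M: "degree M = k" "lead_coeff M = c" "M \<noteq> 0"
        using c(1) by (auto simp: M_def degree_monom_eq)
      have PM: "degree (P + M) = e" "lead_coeff (P + M) = a"
        using P M \<open>k < e\<close> by (auto simp: degree_add_eq_left coeff_eq_0)
      obtain S where S: "(P + M) ^ d - P ^ d = (P + M - P) * S" "degree S = (d - 1) * e"
        "lead_coeff S = of_nat d * a ^ (d - 1)"
        using power_diff_eq_cofactor[of "P + M" e P a d] PM P a assms(2) by metis
      have "S \<noteq> 0" using S(3) a assms(2) by auto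
      have MS: "degree (M * S) = (d - 1) * e + k" "lead_coeff (M * S) = lead_coeff R"
        using \<open>S \<noteq> 0\<close> M S(2) lead_coeff_mult[of M S] S(3) c(2)
        by (simp_all only: degree_mult_eq not_False_eq_True add.commute)
      have E: "A - (P + M) ^ d = R - M * S"
        using S(1) by (simp add: R_def algebra_simps)
      have "degree (R - M * S) \<le> (d - 1) * e + k"
        using R MS by (intro degree_diff_le) auto
      moreover have "coeff (R - M * S) ((d - 1) * e + k) = 0"
        using R(1) MS by simp
      ultimately have "R - M * S = 0 \<or> degree (R - M * S) < (d - 1) * e + k"
        by (metis le_neq_implies_less leading_coeff_0_iff)
      then have "A = (P + M) ^ d \<or> degree (A - (P + M) ^ d) < (d - 1) * e + k"
        using E by (metis right_minus_eq)
      with PM show ?thesis by blast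
    qed
  qed
  from this[of 0] that show ?thesis by auto
qed

text \<open>Here \<open>G = P \<circ> C = Q \<circ> B\<close> has the least possible positive degree among polynomials in both
  \<open>C\<close> and \<open>B\<close>; the hypothesis on \<open>i\<close> and \<open>j\<close> expresses this through degrees.  Expand \<open>A \<circ> C = D \<circ> B\<close>
  in powers of \<open>G\<close>, by repeated division with remainder.  Dividing \<open>A\<close> by \<open>P\<close> and dividing \<open>D\<close> by \<open>Q\<close>
  yield the same expansion, so each digit is a polynomial in both \<open>C\<close> and \<open>B\<close> of degree below that
  of \<open>G\<close>, that is, a constant.  The constants are the coefficients of \<open>U\<close>.\<close>

lemma common_left_factor_of_intersection:
  fixes A C D B P Q :: "complex poly"
  assumes "A \<circ>\<^sub>p C = D \<circ>\<^sub>p B" "P \<circ>\<^sub>p C = Q \<circ>\<^sub>p B" "degree P > 0" "degree C > 0" "degree B > 0"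
    and minimal: "\<And>i j. i * degree C = j * degree B \<Longrightarrow> i < degree P \<Longrightarrow> i = 0"
  shows "\<exists>U. A = U \<circ>\<^sub>p P \<and> D = U \<circ>\<^sub>p Q"
  using assms(1)
proof (induction "degree A" arbitrary: A D rule: less_induct)
  case less
  have degQ: "degree P * degree C = degree Q * degree B"
    using assms(2) by (metis degree_pcompose)
  then have "degree Q > 0" using assms(3-5) by (metis mult_is_0 gr0I)
  show ?case
  proof (cases "degree A = 0")
    case True
    then obtain c where "A = [:c:]" by (metis degree_eq_zeroE)
    moreover have "D = [:c:]"
      using less(2) assms(5) \<open>A = [:c:]\<close> by (metis pcompose_const pcompose_right_cancel)
    ultimately show ?thesis by (intro exI[of _ "[:c:]"]) simp
  next
    case False
    define q r q' r' where "q = A div P" and "r = A mod P" and "q' = D div Q" and "r' = D mod Q"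
    have r: "degree r < degree P" and r': "degree r' < degree Q"
      using degree_mod_less[of P A] degree_mod_less[of Q D] assms(3) \<open>degree Q > 0\<close>
      by (force simp: r_def r'_def)+
    have A: "A = q * P + r" and D: "D = q' * Q + r'"
      by (simp_all add: q_def r_def q'_def r'_def)
    define G where "G = P \<circ>\<^sub>p C"
    have G: "G = Q \<circ>\<^sub>p B" "G \<noteq> 0" using assms by (auto simp: G_def pcompose_eq_0_iff)
    have "(q \<circ>\<^sub>p C) * G + r \<circ>\<^sub>p C = (q' \<circ>\<^sub>p B) * G + r' \<circ>\<^sub>p B"
      using less(2) G(1) by (simp add: A D G_def pcompose_add pcompose_mult)
    then have eq: "(q \<circ>\<^sub>p C - q' \<circ>\<^sub>p B) * G = r' \<circ>\<^sub>p B - r \<circ>\<^sub>p C"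
      by (simp add: algebra_simps)
    have dG: "degree G = degree P * degree C" "degree G = degree Q * degree B"
      using degQ by (simp_all add: G_def degree_pcompose)
    have "degree r * degree C < degree G" "degree r' * degree B < degree G"
      using r r' assms(4,5) by (simp only: dG(1), simp, simp only: dG(2), simp)
    then have "degree (r' \<circ>\<^sub>p B - r \<circ>\<^sub>p C) < degree G"
      by (intro degree_diff_less) (simp_all add: degree_pcompose)
    then have "degree ((q \<circ>\<^sub>p C - q' \<circ>\<^sub>p B) * G) < degree G" by (simp only: eq)
    then have "q \<circ>\<^sub>p C - q' \<circ>\<^sub>p B = 0"
      using G(2) by (cases "q \<circ>\<^sub>p C - q' \<circ>\<^sub>p B = 0") (simp_all add: degree_mult_eq)
    then have "q \<circ>\<^sub>p C = q' \<circ>\<^sub>p B" by simp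
    moreover from this eq have rr: "r \<circ>\<^sub>p C = r' \<circ>\<^sub>p B" by simp
    moreover have "degree q < degree A"
      using False assms(3) by (simp add: q_def degree_div_less)
    ultimately obtain U where U: "q = U \<circ>\<^sub>p P" "q' = U \<circ>\<^sub>p Q"
      using less(1) by blast
    have "degree r = 0"
      using minimal[of "degree r" "degree r'"] rr r by (metis degree_pcompose)
    then obtain c where c: "r = [:c:]" by (metis degree_eq_zeroE)
    with rr have "r' = [:c:]"
      using assms(5) c by (metis pcompose_const pcompose_right_cancel)
    then show ?thesis using A D U c
      by (intro exI[of _ "pCons c U"]) (simp add: pcompose_pCons mult.commute add.commute)
  qed
qed

text \<open>Engstrom's theorem on the polynomials \<open>A \<circ> C = D \<circ> B\<close>.  With \<open>d\<close> the greatest common divisor of the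
  degrees, \<open>P\<close> and \<open>Q\<close> are the approximate \<open>d\<close>-th roots of \<open>A\<close> and \<open>D\<close>.\<close>

theorem common_left_factor:
  fixes A C D B :: "complex poly"
  assumes eq: "A \<circ>\<^sub>p C = D \<circ>\<^sub>p B"
    and pos: "degree A > 0" "degree C > 0" "degree D > 0" "degree B > 0"
  obtains U P Q where "A = U \<circ>\<^sub>p P" "D = U \<circ>\<^sub>p Q" "P \<circ>\<^sub>p C = Q \<circ>\<^sub>p B"
    "degree U = gcd (degree A) (degree D)"
proof -
  define d where "d = gcd (degree A) (degree D)"
  have "d > 0" using pos by (simp add: d_def)
  obtain e f where e: "degree A = d * e" and f: "degree D = d * f"
    unfolding d_def by (metis dvdE gcd_dvd1 gcd_dvd2)
  then have "e > 0" "f > 0" using pos by auto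
  have "coprime e f"
  proof -
    have "gcd (d * e) (d * f) = d" by (simp only: e[symmetric] f[symmetric] d_def[symmetric])
    then have "d * gcd e f = d" by (simp only: gcd_mult_distrib_nat)
    then show ?thesis using \<open>d > 0\<close> by (simp add: coprime_iff_gcd_eq_1)
  qed
  have degs: "e * degree C = f * degree B"
    using arg_cong[OF eq, of degree] e f \<open>d > 0\<close> by (simp add: degree_pcompose mult.assoc)
  have A0: "A \<noteq> 0" "D \<noteq> 0" using pos by auto
  obtain a where a: "a ^ d = lead_coeff A"
    using nth_root_exists[OF \<open>d > 0\<close>] by metis
  obtain P where P: "degree P = e" "lead_coeff P = a" "A = P ^ d \<or> degree (A - P ^ d) < (d - 1) * e"
    using approximate_root_exists[OF e \<open>d > 0\<close> a] A0 by blast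
  have "a \<noteq> 0" using P(1,2) \<open>e > 0\<close> by auto
  \<comment> \<open>The \<open>d\<close>-th root \<open>b\<close> of the leading coefficient of \<open>D\<close> is chosen so that \<open>P \<circ> C\<close> and \<open>Q \<circ> B\<close> get equal leading coefficients.\<close>
  define b where "b = a * lead_coeff C ^ e / lead_coeff B ^ f"
  have nz: "lead_coeff B \<noteq> 0" "lead_coeff C \<noteq> 0" using pos by auto
  have "lead_coeff A * lead_coeff C ^ (d * e) = lead_coeff D * lead_coeff B ^ (d * f)"
    using arg_cong[OF eq, of lead_coeff] lead_coeff_comp[OF pos(2), of A] lead_coeff_comp[OF pos(4), of D]
    by (simp only: e f)
  then have b: "b ^ d = lead_coeff D"
    using nz a by (simp add: b_def power_divide power_mult_distrib mult.commute flip: power_mult)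
  obtain Q where Q: "degree Q = f" "lead_coeff Q = b" "D = Q ^ d \<or> degree (D - Q ^ d) < (d - 1) * f"
    using approximate_root_exists[OF f \<open>d > 0\<close> b] A0 by blast
  \<comment> \<open>Both \<open>P \<circ> C\<close> and \<open>Q \<circ> B\<close> are approximate roots of the same polynomial.\<close>
  have PQ: "P \<circ>\<^sub>p C = Q \<circ>\<^sub>p B"
  proof (rule approximate_root_unique)
    show "degree (P \<circ>\<^sub>p C) = e * degree C" "degree (Q \<circ>\<^sub>p B) = e * degree C"
      by (simp_all add: degree_pcompose P Q degs)
    show "lead_coeff (P \<circ>\<^sub>p C) = lead_coeff (Q \<circ>\<^sub>p B)"
      using lead_coeff_comp[OF pos(2), of P] lead_coeff_comp[OF pos(4), of Q] P(1,2) Q(1,2) nz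
      by (simp add: b_def)
    show "P \<circ>\<^sub>p C \<noteq> 0" using P \<open>a \<noteq> 0\<close> pos by (auto simp: pcompose_eq_0_iff)
    show "d > 0" by fact
    have pw: "(X ^ d) \<circ>\<^sub>p Y = (X \<circ>\<^sub>p Y) ^ d" for X Y :: "complex poly"
      by (induction d) (simp_all add: pcompose_mult pcompose_1)
    define R S where "R = A - P ^ d" and "S = D - Q ^ d"
    have RS: "(P \<circ>\<^sub>p C) ^ d - (Q \<circ>\<^sub>p B) ^ d = S \<circ>\<^sub>p B - R \<circ>\<^sub>p C"
      using eq by (simp add: R_def S_def pcompose_diff pw)
    have R: "R \<circ>\<^sub>p C = 0 \<or> degree (R \<circ>\<^sub>p C) < (d - 1) * (e * degree C)"
      using P(3) pos(2) by (auto simp: R_def degree_pcompose simp flip: mult.assoc)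
    have S: "S \<circ>\<^sub>p B = 0 \<or> degree (S \<circ>\<^sub>p B) < (d - 1) * (e * degree C)"
      unfolding degs using Q(3) pos(4) by (auto simp: S_def degree_pcompose simp flip: mult.assoc)
    show "(P \<circ>\<^sub>p C) ^ d = (Q \<circ>\<^sub>p B) ^ d \<or> degree ((P \<circ>\<^sub>p C) ^ d - (Q \<circ>\<^sub>p B) ^ d) < (d - 1) * (e * degree C)"
      using R S degree_diff_less[of "S \<circ>\<^sub>p B" "(d - 1) * (e * degree C)" "R \<circ>\<^sub>p C"] RS
      by (cases "R \<circ>\<^sub>p C = 0"; cases "S \<circ>\<^sub>p B = 0") auto
  qed
  have minimal: "i = 0" if ij: "i * degree C = j * degree B" "i < degree P" for i j
  proof -
    have "(i * f) * degree B = (j * e) * degree B"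
    proof -
      have "(i * f) * degree B = i * (e * degree C)" by (simp add: degs)
      also have "\<dots> = (i * degree C) * e" by simp
      also have "\<dots> = (j * e) * degree B" by (simp add: ij(1))
      finally show ?thesis .
    qed
    then have "i * f = j * e" using pos by simp
    then have "e dvd i * f" by simp
    then have "e dvd i" using \<open>coprime e f\<close> by (simp add: coprime_dvd_mult_left_iff)
    with ij(2) P(1) show "i = 0" using nat_dvd_not_less by blast
  qed
  have "degree P > 0" using P(1) \<open>e > 0\<close> by simp
  have "\<exists>U. A = U \<circ>\<^sub>p P \<and> D = U \<circ>\<^sub>p Q"
    by (rule common_left_factor_of_intersection[of A C D B P Q]) fact+
  then obtain U where "A = U \<circ>\<^sub>p P \<and> D = U \<circ>\<^sub>p Q" ..
  then have U: "A = U \<circ>\<^sub>p P" "D = U \<circ>\<^sub>p Q" by (rule conjunct1, rule conjunct2)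
  from U(1) have "degree U * e = d * e" using e P(1) degree_pcompose[of U P] by simp
  then have "degree U = d" using \<open>e > 0\<close> by simp
  with that U PQ show ?thesis unfolding d_def by blast
qed

section \<open>Reduction of a semiconjugacy to coprime degrees\<close>

text \<open>If \<open>A = U \<circ> P\<close>, \<open>X = U \<circ> Q\<close> and \<open>P \<circ> X = Q \<circ> B\<close>, then \<open>(P \<circ> U) \<circ> Q = P \<circ> X = Q \<circ> B\<close>, so
  the swap of \<open>A\<close> removes \<open>U\<close> from \<open>X\<close>.  The cofactor \<open>s\<close> collects the degrees of the removed \<open>U\<close>,
  which divide \<open>deg A\<close>; consequently a divisor of \<open>deg X\<close> coprime to \<open>deg A\<close> survives in \<open>deg X'\<close>.\<close>

lemma strip_to_coprime_degree:
  fixes A X B :: "complex poly"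
  assumes "A \<circ>\<^sub>p X = X \<circ>\<^sub>p B" "degree A > 0" "degree B > 0" "degree X > 0"
  shows "\<exists>A' X' s. swap\<^sup>*\<^sup>* A A' \<and> A' \<circ>\<^sub>p X' = X' \<circ>\<^sub>p B \<and> degree X' > 0 \<and>
    coprime (degree X') (degree A) \<and> degree X = degree X' * s \<and>
    (\<forall>r. coprime r (degree A) \<longrightarrow> coprime r s)"
  using assms
proof (induction "degree X" arbitrary: A X rule: less_induct)
  case less
  show ?case
  proof (cases "coprime (degree X) (degree A)")
    case True
    then show ?thesis using less.prems
      by (intro exI[of _ A] exI[of _ X] exI[of _ 1]) auto
  next
    case False
    obtain U P Q where U: "A = U \<circ>\<^sub>p P" "X = U \<circ>\<^sub>p Q" "P \<circ>\<^sub>p X = Q \<circ>\<^sub>p B"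
      "degree U = gcd (degree A) (degree X)"
      by (rule common_left_factor[of A X X B]) (use less.prems in auto)
    have "degree U \<noteq> 1" using False U(4) by (simp add: coprime_iff_gcd_eq_1 gcd.commute)
    moreover have degX: "degree X = degree Q * degree U" and degA: "degree A = degree U * degree P"
      using U(1,2) degree_pcompose[of U Q] degree_pcompose[of U P] by (simp_all only: mult.commute)
    moreover have "degree U > 0" "degree Q > 0"
      using degX degA less.prems by (auto intro: gr0I)
    ultimately have "degree U > 1" "degree Q > 0" by auto
    then have "degree Q < degree X" using degX by simp
    have A1: "degree (P \<circ>\<^sub>p U) = degree A" by (simp add: degree_pcompose degA)
    have "(P \<circ>\<^sub>p U) \<circ>\<^sub>p Q = Q \<circ>\<^sub>p B" using U(2,3) by (metis pcompose_assoc)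
    from less.hyps[OF \<open>degree Q < degree X\<close> this] A1 less.prems \<open>degree Q > 0\<close>
    obtain A' X' s where IH: "swap\<^sup>*\<^sup>* (P \<circ>\<^sub>p U) A'" "A' \<circ>\<^sub>p X' = X' \<circ>\<^sub>p B" "degree X' > 0"
      "coprime (degree X') (degree A)" "degree Q = degree X' * s"
      "\<forall>r. coprime r (degree A) \<longrightarrow> coprime r s" by (metis (no_types, lifting))
    have "swap\<^sup>*\<^sup>* A A'"
      by (rule converse_rtranclp_into_rtranclp[OF _ IH(1)]) (use U(1) in \<open>auto simp: swap_def\<close>)
    moreover have "coprime r (s * degree U)" if "coprime r (degree A)" for r
      using that IH(6) degA by auto
    ultimately show ?thesis using IH degX
      by (intro exI[of _ A'] exI[of _ X'] exI[of _ "s * degree U"]) auto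
  qed
qed

section \<open>Fibres in a semiconjugacy of coprime degrees\<close>

lemma linear_dependence_of_bounded_degree:
  fixes p :: "nat \<Rightarrow> complex poly"
  assumes "finite S" "card S = Suc c" "\<And>i k. i \<in> S \<Longrightarrow> k \<ge> c \<Longrightarrow> coeff (p i) k = 0"
  shows "\<exists>l. (\<exists>i\<in>S. l i \<noteq> 0) \<and> (\<Sum>i\<in>S. smult (l i) (p i)) = 0"
  using assms
proof (induction c arbitrary: S p)
  case 0
  then have "p i = 0" if "i \<in> S" for i using that by (intro poly_eqI) auto
  moreover have "S \<noteq> {}" using 0 by auto
  ultimately show ?case by (intro exI[of _ "\<lambda>_. 1"]) auto
next
  case (Suc c)
  show ?case
  proof (cases "\<forall>i\<in>S. coeff (p i) c = 0")
    case True
    have "S \<noteq> {}" using Suc by auto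
    then obtain j where j: "j \<in> S" by auto
    have "\<exists>l. (\<exists>i\<in>S-{j}. l i \<noteq> 0) \<and> (\<Sum>i\<in>S-{j}. smult (l i) (p i)) = 0"
    proof (rule Suc.IH)
      show "coeff (p i) k = 0" if "i \<in> S - {j}" "c \<le> k" for i k
        using that True Suc.prems(3)[of i k] by (cases "k = c") auto
    qed (use Suc.prems j in auto)
    then obtain l where l: "\<exists>i\<in>S-{j}. l i \<noteq> 0" "(\<Sum>i\<in>S-{j}. smult (l i) (p i)) = 0" by blast
    then show ?thesis using j Suc.prems(1)
      by (intro exI[of _ "l(j := 0)"]) (auto simp: sum.remove[of S j] intro!: sum.neutral)
  next
    case False
    then obtain j where j: "j \<in> S" "coeff (p j) c \<noteq> 0" by auto
    define t where "t i = coeff (p i) c / coeff (p j) c" for i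
    have "\<exists>l. (\<exists>i\<in>S-{j}. l i \<noteq> 0) \<and> (\<Sum>i\<in>S-{j}. smult (l i) (p i - smult (t i) (p j))) = 0"
    proof (rule Suc.IH)
      show "coeff (p i - smult (t i) (p j)) k = 0" if "i \<in> S - {j}" "c \<le> k" for i k
        using that Suc.prems(3)[of i k] Suc.prems(3)[of j k] j by (cases "k = c") (auto simp: t_def)
    qed (use Suc.prems j in auto)
    then obtain l where l: "\<exists>i\<in>S-{j}. l i \<noteq> 0"
      "(\<Sum>i\<in>S-{j}. smult (l i) (p i - smult (t i) (p j))) = 0" by blast
    define l' where "l' = l(j := - (\<Sum>i\<in>S-{j}. l i * t i))"
    have "(\<Sum>i\<in>S. smult (l' i) (p i)) = smult (l' j) (p j) + (\<Sum>i\<in>S-{j}. smult (l i) (p i))"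
      using j Suc.prems(1) by (simp add: sum.remove[of S j] l'_def)
    also have "(\<Sum>i\<in>S-{j}. smult (l i) (p i)) = smult (\<Sum>i\<in>S-{j}. l i * t i) (p j)"
      using l(2) by (simp add: smult_diff_right sum_subtractf smult_sum)
    finally have "(\<Sum>i\<in>S. smult (l' i) (p i)) = 0" by (simp add: l'_def)
    with l(1) show ?thesis by (intro exI[of _ l']) (auto simp: l'_def)
  qed
qed

lemma coprime_degrees_generate:
  fixes m n k :: nat
  assumes "coprime m n" "m > 0" "n > 0" "k \<ge> m * n"
  obtains i j where "k = i * m + j * n"
proof -
  obtain x where x: "[n * x = 1] (mod m)"
    using cong_solve_coprime_nat[of n m] assms(1) by (auto simp: coprime_commute)
  define j where "j = (k * x) mod m"
  have "[n * j = k * (n * x)] (mod m)"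
    by (simp add: j_def cong_def mod_mult_right_eq mult.left_commute)
  also have "[k * (n * x) = k * 1] (mod m)" by (intro cong_mult x cong_refl)
  finally have "[n * j = k] (mod m)" by simp
  moreover have "n * j \<le> k"
  proof -
    have "j < m" using assms(2) by (simp add: j_def)
    then have "n * j \<le> n * m" by simp
    with assms(4) show ?thesis by (metis le_trans mult.commute)
  qed
  ultimately have "m dvd k - n * j"
    using mod_eq_dvd_iff_nat[of "n * j" k m] by (simp add: cong_def)
  then obtain i where "k - n * j = m * i" by (elim dvdE)
  with \<open>n * j \<le> k\<close> have "k = i * m + j * n" by (simp add: mult.commute)
  with that show ?thesis by blast
qed

text \<open>The set \<open>R\<close> of polynomials that do not distinguish points with equal values of \<open>C\<close> and \<open>g\<close> is an
  algebra containing \<open>C\<close> and \<open>g\<close>.  As the degrees are coprime, \<open>R\<close> has elements of every large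
  degree, hence finite codimension.  So among the polynomials \<open>C\<^bsup>i\<^esup> z\<close> some nontrivial combination
  \<open>q(C) z\<close> lies in \<open>R\<close>.\<close>

lemma generic_separation:
  fixes C g :: "complex poly"
  assumes "coprime (degree C) (degree g)" "degree C > 0" "degree g > 0"
  shows "\<exists>q. q \<noteq> 0 \<and>
    (\<forall>z w. poly C z = poly C w \<longrightarrow> poly g z = poly g w \<longrightarrow> poly q (poly C z) = 0 \<or> z = w)"
proof -
  define R where "R = {h. \<forall>z w. poly C z = poly C w \<longrightarrow> poly g z = poly g w \<longrightarrow> poly h z = poly h w}"
  \<comment> \<open>Every degree from \<open>c\<close> on is that of a monomial in \<open>C\<close> and \<open>g\<close>.\<close>
  define c where "c = degree C * degree g"
  have "c > 0" using assms by (simp add: c_def)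
  have red: "\<exists>r\<in>R. \<forall>k\<ge>c. coeff (h - r) k = 0" for h
  proof (induction "degree h" arbitrary: h rule: less_induct)
    case less
    show ?case
    proof (cases "degree h < c")
      case True
      then show ?thesis by (intro bexI[of _ 0]) (simp_all add: coeff_eq_0 R_def)
    next
      case False
      then have ge: "degree h \<ge> degree C * degree g" by (simp add: c_def)
      obtain i j where ij: "degree h = i * degree C + j * degree g"
        by (rule coprime_degrees_generate[OF assms ge])
      define T where "T = C ^ i * g ^ j"
      have nz: "C \<noteq> 0" "g \<noteq> 0" using assms by auto
      then have T: "degree T = degree h" "T \<noteq> 0"
        by (auto simp: T_def ij degree_mult_eq degree_power_eq)
      have "T \<in> R" by (simp add: T_def R_def poly_power)
      define a where "a = lead_coeff h / lead_coeff T"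
      have "a * lead_coeff T = lead_coeff h" using T(2) by (simp add: a_def)
      define h1 where "h1 = h - smult a T"
      have h0: "degree h > 0"
        using False \<open>c > 0\<close> by simp
      have "degree h1 \<le> degree h" unfolding h1_def
        using T by (intro degree_diff_le) auto
      moreover have "coeff h1 (degree h) = 0"
        using \<open>a * lead_coeff T = lead_coeff h\<close> T by (simp add: h1_def)
      ultimately have "degree h1 < degree h"
        using h0 by (metis degree_0 le_neq_implies_less leading_coeff_0_iff)
      from less[OF this] obtain r where r: "r \<in> R" "\<forall>k\<ge>c. coeff (h1 - r) k = 0" by blast
      have "smult a T + r \<in> R" using r(1) \<open>T \<in> R\<close>
        unfolding R_def mem_Collect_eq poly_add poly_smult by metis
      moreover have "h - (smult a T + r) = h1 - r" by (simp add: h1_def)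
      ultimately show ?thesis using r(2) by metis
    qed
  qed
  then have "\<forall>i. \<exists>r. r \<in> R \<and> (\<forall>k\<ge>c. coeff (C ^ i * [:0, 1:] - r) k = 0)" by blast
  then have "\<exists>r. \<forall>i. r i \<in> R \<and> (\<forall>k\<ge>c. coeff (C ^ i * [:0, 1:] - r i) k = 0)" by (rule choice)
  then obtain r where r: "\<forall>i. r i \<in> R \<and> (\<forall>k\<ge>c. coeff (C ^ i * [:0, 1:] - r i) k = 0)" ..
  have "\<exists>l. (\<exists>i\<in>{..c}. l i \<noteq> 0) \<and> (\<Sum>i\<le>c. smult (l i) (C ^ i * [:0, 1:] - r i)) = 0"
  proof (rule linear_dependence_of_bounded_degree[of "{..c}" c])
    show "coeff (C ^ i * [:0, 1:] - r i) k = 0" if "k \<ge> c" for i k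
      using r that by blast
  qed simp_all
  then obtain l where l: "\<exists>i\<in>{..c}. l i \<noteq> 0" "(\<Sum>i\<le>c. smult (l i) (C ^ i * [:0, 1:] - r i)) = 0"
    by (elim exE conjE)
  define q where "q = (\<Sum>i\<le>c. monom (l i) i)"
  have "coeff q i = l i" if "i \<le> c" for i
    using that by (simp add: q_def coeff_sum coeff_monom)
  then have "q \<noteq> 0" using l(1) by force
  have q: "poly q (poly C z) * z = (\<Sum>i\<le>c. l i * poly (r i) z)" for z
  proof -
    have "0 = poly (\<Sum>i\<le>c. smult (l i) (C ^ i * [:0, 1:] - r i)) z" by (simp only: l(2) poly_0)
    also have "\<dots> = (\<Sum>i\<le>c. l i * poly C z ^ i * z - l i * poly (r i) z)"
      by (simp add: poly_sum right_diff_distrib mult_ac)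
    also have "\<dots> = poly q (poly C z) * z - (\<Sum>i\<le>c. l i * poly (r i) z)"
      by (simp add: q_def poly_sum poly_monom sum_distrib_left sum_subtractf mult_ac)
    finally show ?thesis by simp
  qed
  have "poly q (poly C z) = 0 \<or> z = w" if eq: "poly C z = poly C w" "poly g z = poly g w" for z w
  proof -
    have "poly (r i) z = poly (r i) w" for i
      using r[rule_format, of i] eq unfolding R_def by blast
    then have "poly q (poly C z) * z = poly q (poly C w) * w" by (simp add: q)
    with eq show ?thesis by simp
  qed
  with \<open>q \<noteq> 0\<close> show ?thesis by blast
qed

text \<open>Suppose \<open>z \<noteq> w\<close>.  Near \<open>y = g z = g w\<close> the polynomial \<open>D\<close> is injective, so \<open>D \<circ> g = f \<circ> C\<close> makes
  \<open>g\<close> locally the same function of \<open>C\<close> near \<open>z\<close> as near \<open>w\<close>.  By the open mapping theorem infinitely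
  many values of \<open>C\<close> are then attained at a point near \<open>z\<close> and at one near \<open>w\<close> with equal \<open>g\<close>,
  which contradicts generic separation.\<close>

lemma fibre_injective:
  fixes f C D g :: "complex poly"
  assumes eq: "f \<circ>\<^sub>p C = D \<circ>\<^sub>p g"
    and cop: "coprime (degree C) (degree g)" "degree C > 0" "degree g > 0"
    and y: "poly (pderiv D) (poly g z) \<noteq> 0"
    and zw: "poly g z = poly g w" "poly C z = poly C w"
  shows "z = w"
proof (rule ccontr)
  assume "z \<noteq> w"
  obtain q where "q \<noteq> 0 \<and>
    (\<forall>z w. poly C z = poly C w \<longrightarrow> poly g z = poly g w \<longrightarrow> poly q (poly C z) = 0 \<or> z = w)"
    using generic_separation[OF cop] ..
  then have q: "q \<noteq> 0"
    "\<And>z w. poly C z = poly C w \<Longrightarrow> poly g z = poly g w \<Longrightarrow> poly q (poly C z) = 0 \<or> z = w"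
    by simp_all
  have "deriv (poly D) (poly g z) \<noteq> 0"
    using y DERIV_imp_deriv[OF poly_DERIV[of D "poly g z"]] by simp
  then obtain r where r: "r > 0" "inj_on (poly D) (ball (poly g z) r)"
    by (rule has_complex_derivative_locally_injective[of "poly D" UNIV "poly g z", rotated 3])
      (auto intro: holomorphic_intros)
  define N where "N = poly g -` ball (poly g z) r"
  have "open N" unfolding N_def
    by (intro open_vimage continuous_intros) auto
  define V W where "V = N \<inter> ball z (dist z w / 2)" and "W = N \<inter> ball w (dist z w / 2)"
  have VW: "open V" "open W" "z \<in> V" "w \<in> W"
    using \<open>open N\<close> \<open>z \<noteq> w\<close> r(1) zw by (auto simp: V_def W_def N_def)
  have disj: "V \<inter> W = {}"
  proof -
    have "ball z (dist z w / 2) \<inter> ball w (dist z w / 2) = {}"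
      by (rule disjoint_ballI) simp
    then show ?thesis by (auto simp: V_def W_def)
  qed
  have nc: "\<not> poly C constant_on UNIV"
  proof
    assume "poly C constant_on UNIV"
    then have "constant (poly C)" unfolding constant_on_def constant_def by (metis UNIV_I)
    with cop(2) show False by (simp add: constant_degree)
  qed
  have op: "open (poly C ` S)" if "open S" for S
    by (rule open_mapping_thm[OF _ open_UNIV connected_UNIV that _ nc]) (auto intro: holomorphic_intros)
  define O1 where "O1 = poly C ` V \<inter> poly C ` W"
  have "poly C z \<in> poly C ` V" "poly C w \<in> poly C ` W" using VW by blast+
  then have "poly C z \<in> O1" by (simp add: O1_def zw(2))
  moreover have "open O1" unfolding O1_def by (intro open_Int op VW)
  ultimately have "infinite O1" using finite_imp_not_open by blast
  moreover have "poly q t = 0" if t: "t \<in> O1" for t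
  proof -
    obtain a b where ab: "a \<in> V" "b \<in> W" "poly C a = t" "poly C b = t"
      using t by (auto simp: O1_def)
    have "poly D (poly g a) = poly f (poly C a)" "poly D (poly g b) = poly f (poly C b)"
      using arg_cong[OF eq, of "\<lambda>p. poly p a"] arg_cong[OF eq, of "\<lambda>p. poly p b"]
      by (simp_all add: poly_pcompose)
    then have "poly D (poly g a) = poly D (poly g b)" using ab by simp
    moreover have "poly g a \<in> ball (poly g z) r" "poly g b \<in> ball (poly g z) r"
      using ab by (auto simp: V_def W_def N_def)
    ultimately have "poly g a = poly g b" using r(2) by (auto dest: inj_onD)
    then have "poly q t = 0 \<or> a = b" using q(2)[of a b] ab by simp
    then show ?thesis using ab disj by blast
  qed
  then have "O1 \<subseteq> {t. poly q t = 0}" by blast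
  ultimately show False using poly_roots_finite[OF q(1)] finite_subset by blast
qed

section \<open>Ramification\<close>

definition fibre :: "complex poly \<Rightarrow> complex \<Rightarrow> complex set" where
  "fibre p v = {z. poly p z = v}"

text \<open>The number of points missing from the fibre over \<open>v\<close>: the sum of (ramification index - 1)
  over that fibre.\<close>

definition ram :: "complex poly \<Rightarrow> complex \<Rightarrow> nat" where
  "ram p v = degree p - card (fibre p v)"

lemma fibre_eq_roots: "fibre p v = {z. poly (p - [:v:]) z = 0}"
  by (auto simp: fibre_def)

lemma minus_const_nonzero: "degree p > 0 \<Longrightarrow> p - [:v:] \<noteq> (0 :: complex poly)"
  by auto

lemma finite_fibre: "degree p > 0 \<Longrightarrow> finite (fibre p v)"
  unfolding fibre_eq_roots by (intro poly_roots_finite minus_const_nonzero)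

lemma order_minus_const:
  fixes p :: "complex poly"
  assumes "degree p > 0" "poly p z = v"
  shows "order z (p - [:v:]) = Suc (order z (pderiv p))"
  using order_pderiv[of "p - [:v:]" z] minus_const_nonzero[OF assms(1), of v] assms(2)
  by (simp add: pderiv_diff pderiv_pCons)

lemma degree_minus_const: "degree (p - [:v:]) = degree (p :: complex poly)"
proof (cases "degree p = 0")
  case False
  have "p - [:v:] = p + [:-v:]" by (rule poly_eqI) (simp add: coeff_pCons split: nat.split)
  with False show ?thesis using degree_add_eq_left[of "[:-v:]" p]
    by (metis degree_pCons_0 gr0I)
qed (auto elim!: degree_eq_zeroE)

lemma degree_eq_sum_order:
  assumes "degree p > 0"
  shows "degree p = (\<Sum>z\<in>fibre p v. Suc (order z (pderiv p)))"
proof -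
  have nz: "p - [:v:] \<noteq> 0" using minus_const_nonzero[OF assms] .
  have "degree p = size (proots (p - [:v:]))"
    by (simp add: size_proots_complex degree_minus_const)
  also have "\<dots> = (\<Sum>z\<in>fibre p v. order z (p - [:v:]))"
    using nz by (simp add: size_multiset_overloaded_eq fibre_eq_roots)
  also have "\<dots> = (\<Sum>z\<in>fibre p v. Suc (order z (pderiv p)))"
    by (rule sum.cong) (use order_minus_const[OF assms] in \<open>auto simp: fibre_def\<close>)
  finally show ?thesis .
qed

lemma ram_eq_sum_order:
  assumes "degree p > 0"
  shows "ram p v = (\<Sum>z\<in>fibre p v. order z (pderiv p))"
  using degree_eq_sum_order[OF assms, of v] by (simp add: ram_def sum_Suc)

lemma card_fibre_add_ram: "degree p > 0 \<Longrightarrow> card (fibre p v) + ram p v = degree p"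
  using degree_eq_sum_order[of p v] ram_eq_sum_order[of p v] by (simp add: sum_Suc)

lemma pderiv_nonzero: "degree (p :: complex poly) > 0 \<Longrightarrow> pderiv p \<noteq> 0"
  by (metis pderiv_eq_0_iff less_irrefl)

lemma ram_pos_iff:
  assumes "degree p > 0"
  shows "ram p v > 0 \<longleftrightarrow> (\<exists>z. poly p z = v \<and> poly (pderiv p) z = 0)"
proof -
  have "ram p v = 0 \<longleftrightarrow> (\<forall>z\<in>fibre p v. order z (pderiv p) = 0)"
    unfolding ram_eq_sum_order[OF assms] using finite_fibre[OF assms] by (rule sum_eq_0_iff)
  then show ?thesis
    using order_root[of "pderiv p"] pderiv_nonzero[OF assms] by (auto simp: fibre_def)
qed

text \<open>The Riemann-Hurwitz inequality: ramification is counted by the zeros of the derivative.\<close>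

lemma sum_ram_le:
  assumes "degree p > 0" "finite S"
  shows "(\<Sum>v\<in>S. ram p v) \<le> degree p - 1"
proof -
  let ?o = "\<lambda>z. order z (pderiv p)" and ?Z = "{z. poly (pderiv p) z = 0}"
  note nz = pderiv_nonzero[OF assms(1)]
  have finZ: "finite ?Z" using nz by (rule poly_roots_finite)
  have fin: "finite (\<Union>v\<in>S. fibre p v)" using assms finite_fibre by auto
  have "(\<Sum>v\<in>S. ram p v) = (\<Sum>v\<in>S. \<Sum>z\<in>fibre p v. ?o z)"
    by (simp add: ram_eq_sum_order[OF assms(1)])
  also have "\<dots> = (\<Sum>z\<in>(\<Union>v\<in>S. fibre p v). ?o z)"
    by (rule sum.UNION_disjoint[symmetric]) (use assms finite_fibre in \<open>auto simp: fibre_def\<close>)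
  also have "\<dots> = (\<Sum>z\<in>(\<Union>v\<in>S. fibre p v) \<inter> ?Z. ?o z)"
    by (rule sum.mono_neutral_right) (use fin order_root[of "pderiv p"] nz in \<open>auto\<close>)
  also have "\<dots> \<le> (\<Sum>z\<in>?Z. ?o z)"
    by (rule sum_mono2) (use finZ in auto)
  also have "\<dots> \<le> degree (pderiv p)" by (rule sum_order_le_degree[OF nz])
  also have "\<dots> = degree p - 1" by (rule degree_pderiv)
  finally show ?thesis .
qed

definition simple_points :: "complex poly \<Rightarrow> complex \<Rightarrow> complex set" where
  "simple_points p v = {z. poly p z = v \<and> poly (pderiv p) z \<noteq> 0}"

text \<open>A point that is not simple has index \<open>e \<ge> 2\<close>, and then \<open>e \<le> 2 (e - 1)\<close>.\<close>

lemma degree_le_simple_plus_ram: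
  assumes "degree p > 0"
  shows "degree p \<le> card (simple_points p v) + 2 * ram p v"
proof -
  note fin = finite_fibre[OF assms, of v]
  let ?o = "\<lambda>z. order z (pderiv p)"
  have "degree p = (\<Sum>z\<in>fibre p v. Suc (?o z))" by (rule degree_eq_sum_order[OF assms])
  also have "\<dots> \<le> (\<Sum>z\<in>fibre p v. of_bool (poly (pderiv p) z \<noteq> 0) + 2 * ?o z)"
    by (rule sum_mono) (use order_root[of "pderiv p"] pderiv_nonzero[OF assms] in \<open>auto simp: Suc_le_eq\<close>)
  also have "\<dots> = card (simple_points p v) + 2 * ram p v"
    using fin by (simp add: sum.distrib ram_eq_sum_order[OF assms] sum_distrib_left simple_points_def
        fibre_def Int_def conj_commute)
  finally show ?thesis .
qed

text \<open>By \<open>fibre_injective\<close>, \<open>C\<close> embeds the fibre of \<open>g\<close> over \<open>y\<close> into the fibre of \<open>f\<close> over \<open>D y\<close>.\<close>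

lemma ram_le_ram_above_unramified:
  fixes f C D g :: "complex poly"
  assumes eq: "f \<circ>\<^sub>p C = D \<circ>\<^sub>p g" and deg: "degree f = degree g"
    and cop: "coprime (degree C) (degree g)" "degree C > 0" "degree g > 0"
    and y: "poly (pderiv D) y \<noteq> 0"
  shows "ram f (poly D y) \<le> ram g y"
proof -
  have "card (fibre g y) \<le> card (fibre f (poly D y))"
  proof (rule card_inj_on_le)
    show "inj_on (poly C) (fibre g y)"
      using fibre_injective[OF eq cop] y by (intro inj_onI) (auto simp: fibre_def)
    show "poly C ` fibre g y \<subseteq> fibre f (poly D y)"
      using arg_cong[OF eq, of poly] by (auto simp: fibre_def fun_eq_iff poly_pcompose)
    show "finite (fibre f (poly D y))" using finite_fibre deg cop(3) by simp
  qed
  then show ?thesis by (simp add: ram_def deg)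
qed

section \<open>Semiconjugacies of large coprime degree\<close>

text \<open>All \<open>deg A - 1\<close> units of ramification lie over \<open>v\<close>.\<close>

lemma card_fibre_1_if_ramified_only_there:
  fixes A :: "complex poly"
  assumes deg: "degree A > 0" and crit: "\<And>a. poly (pderiv A) a = 0 \<Longrightarrow> poly A a = v"
  shows "card (fibre A v) = 1"
proof -
  have nz: "pderiv A \<noteq> 0" using deg by (rule pderiv_nonzero)
  have "degree A - 1 = size (proots (pderiv A))"
    by (simp add: size_proots_complex degree_pderiv)
  also have "\<dots> = (\<Sum>z | poly (pderiv A) z = 0. order z (pderiv A))"
    using nz by (simp add: size_multiset_overloaded_eq)
  also have "\<dots> \<le> (\<Sum>z\<in>fibre A v. order z (pderiv A))"
    by (rule sum_mono2) (use finite_fibre[OF deg] crit in \<open>auto simp: fibre_def\<close>)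
  also have "\<dots> = ram A v" by (rule ram_eq_sum_order[OF deg, symmetric])
  finally have "degree A - 1 \<le> ram A v" .
  moreover have "ram A v \<le> degree A - 1"
    using sum_ram_le[OF deg, of "{v}"] by simp
  ultimately show ?thesis using card_fibre_add_ram[OF deg, of v] deg by simp
qed

text \<open>Let \<open>T\<close> be the set of points over which \<open>X\<close> is ramified to nearly half of its degree.  It has at
  most two elements, since three of them would exceed the total ramification of \<open>X\<close>.  It contains
  the critical values of \<open>A \<circ> A\<close>: the ramification over such a value propagates to all its simple
  \<open>X\<close>-preimages, of which there are therefore fewer than \<open>deg (A \<circ> A)\<close>.  Reading the equation as
  \<open>X \<circ> B = A \<circ> X\<close>, with the two sides interchanged, shows that \<open>T\<close> also contains the simple
  \<open>A\<close>-preimages of its elements.  The second iterate is used because its critical values include both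
  \<open>A a\<close> and \<open>A (A a)\<close> for every critical point \<open>a\<close> of \<open>A\<close>; if all of these coincide, \<open>A\<close> fixes its
  only critical value.\<close>

theorem coprime_semiconjugacy_dichotomy:
  fixes A X B :: "complex poly"
  assumes eq: "A \<circ>\<^sub>p X = X \<circ>\<^sub>p B" and degs: "degree A \<ge> 2" "degree B = degree A"
    and cop: "coprime (degree X) (degree A)" and big: "degree X \<ge> 3 * degree A ^ 2"
  shows "(\<exists>v. fibre A v = {v}) \<or>
    (\<exists>u v. u \<noteq> v \<and> simple_points A u \<subseteq> {u, v} \<and> simple_points A v \<subseteq> {u, v})"
proof -
  define m n M where "m = degree A" and "n = degree X" and "M = m ^ 2"
  have dA: "degree A > 0" and m: "m \<ge> 2" using degs by (simp_all add: m_def)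
  have M: "M \<ge> 1" and n: "n \<ge> 3 * M" using m big by (simp_all add: M_def m_def n_def)
  then have dX: "degree X > 0" by (simp add: n_def)
  define A2 B2 where "A2 = A \<circ>\<^sub>p A" and "B2 = B \<circ>\<^sub>p B"
  have d2: "degree A2 = M" "degree B2 = M"
    by (simp_all add: A2_def B2_def degree_pcompose degs(2) M_def m_def power2_eq_square)
  have eq2: "A2 \<circ>\<^sub>p X = X \<circ>\<^sub>p B2"
    unfolding A2_def B2_def using eq by (metis pcompose_assoc)
  define T where "T = {v. n \<le> M - 1 + 2 * ram X v}"
  have T_if_ram: "v \<in> T" if v: "ram A2 v > 0" for v
  proof -
    define S where "S = simple_points X v"
    have "finite S" using finite_fibre[OF dX, of v]
      by (rule rev_finite_subset) (auto simp: S_def simple_points_def fibre_def)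
    have "1 \<le> ram B2 y" if "y \<in> S" for y
    proof -
      have "ram A2 (poly X y) \<le> ram B2 y"
        by (rule ram_le_ram_above_unramified[OF eq2])
          (use that cop dX dA M in \<open>auto simp: d2 S_def simple_points_def M_def m_def\<close>)
      with v that show ?thesis by (simp add: S_def simple_points_def)
    qed
    then have "card S \<le> (\<Sum>y\<in>S. ram B2 y)"
      using sum_mono[of S "\<lambda>_. 1" "ram B2"] by simp
    also have "\<dots> \<le> M - 1" using sum_ram_le[of B2 S] \<open>finite S\<close> d2 M by simp
    finally show ?thesis
      using degree_le_simple_plus_ram[OF dX, of v] by (simp add: T_def S_def n_def)
  qed
  have T_few: "card S \<le> 2" if S: "S \<subseteq> T" "finite S" for S
  proof (rule ccontr)
    assume "\<not> card S \<le> 2"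
    then have "3 \<le> card S" by simp
    then obtain S' where S': "S' \<subseteq> S" "card S' = 3" "finite S'" by (rule obtain_subset_with_card_n)
    have "3 * n = (\<Sum>v\<in>S'. n)" using S' by simp
    also have "\<dots> \<le> (\<Sum>v\<in>S'. M - 1 + 2 * ram X v)"
      by (rule sum_mono) (use S S' in \<open>auto simp: T_def\<close>)
    also have "\<dots> = 3 * (M - 1) + 2 * (\<Sum>v\<in>S'. ram X v)"
      using S' by (simp add: sum.distrib sum_distrib_left)
    also have "\<dots> \<le> 3 * (M - 1) + 2 * (n - 1)"
      using sum_ram_le[OF dX S'(3)] by (simp add: n_def)
    finally show False using n M by simp
  qed
  have T_backward: "y \<in> T" if y: "y \<in> simple_points A v" "v \<in> T" for y v
  proof -
    have "ram X (poly A y) \<le> ram X y"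
      by (rule ram_le_ram_above_unramified[OF eq[symmetric]])
        (use y cop dX degs in \<open>auto simp: simple_points_def coprime_commute\<close>)
    with y show ?thesis by (auto simp: T_def simple_points_def)
  qed
  have d2pos: "degree A2 > 0" using d2 M by simp
  \<comment> \<open>The point \<open>a\<close> and any preimage \<open>b\<close> of \<open>a\<close> are critical points of \<open>A \<circ> A\<close>.\<close>
  have crit: "ram A2 (poly A a) > 0" "ram A2 (poly A (poly A a)) > 0"
    if a: "poly (pderiv A) a = 0" for a
  proof -
    have "poly (pderiv A2) a = 0" "poly A2 a = poly A (poly A a)"
      using a by (simp_all add: A2_def pderiv_pcompose poly_pcompose)
    then show "ram A2 (poly A (poly A a)) > 0" using ram_pos_iff[OF d2pos] by blast
    have "degree (A - [:a:]) > 0" using dA by (simp only: degree_minus_const)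
    then obtain b where "poly (A - [:a:]) b = 0" using alg_closed_imp_poly_has_root by blast
    then have "poly A b = a" by simp
    then have "poly (pderiv A2) b = 0" "poly A2 b = poly A a"
      using a by (simp_all add: A2_def pderiv_pcompose poly_pcompose)
    then show "ram A2 (poly A a) > 0" using ram_pos_iff[OF d2pos] by blast
  qed
  have "degree (pderiv A) > 0" using m by (simp add: degree_pderiv m_def)
  then obtain a where a: "poly (pderiv A) a = 0"
    using alg_closed_imp_poly_has_root by blast
  define v where "v = poly A a"
  have v: "ram A2 v > 0" using crit(1)[OF a] by (simp add: v_def)
  show ?thesis
  proof (cases "\<exists>u. u \<noteq> v \<and> ram A2 u > 0")
    case True
    then obtain u where u: "u \<noteq> v" "ram A2 u > 0" by blast
    then have uv: "u \<in> T" "v \<in> T" using T_if_ram v by auto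
    have "y \<in> {u, v}" if "y \<in> T" for y
    proof (rule ccontr)
      assume "y \<notin> {u, v}"
      then have "card {y, u, v} = 3" using u(1) by auto
      with T_few[of "{y, u, v}"] uv that show False by simp
    qed
    with T_backward uv u(1) show ?thesis by blast
  next
    case False
    then have only: "w = v" if "ram A2 w > 0" for w using that by blast
    have "card (fibre A v) = 1"
      by (rule card_fibre_1_if_ramified_only_there[OF dA]) (rule only, rule crit)
    moreover have "v \<in> fibre A v" using only[OF crit(2)[OF a]] by (simp add: fibre_def v_def)
    ultimately have "fibre A v = {v}" by (metis card_1_singletonE singletonD)
    then show ?thesis by blast
  qed
qed

section \<open>Totally invariant points\<close>

text \<open>The set \<open>X\<^bsup>-1\<^esup>(v)\<close> is backward invariant under \<open>B\<close>.  A finite backward invariant set \<open>S\<close> with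
  \<open>deg B \<ge> 2\<close> has one element: its preimage has at least \<open>deg B |S| - (deg B - 1)\<close> elements.\<close>

lemma totally_invariant_point_transfer:
  fixes A X B :: "complex poly"
  assumes eq: "A \<circ>\<^sub>p X = X \<circ>\<^sub>p B" and dX: "degree X > 0" and dB: "degree B \<ge> 2"
    and v: "fibre A v = {v}"
  shows "\<exists>s. fibre B s = {s}"
proof -
  have dB': "degree B > 0" using dB by simp
  define S where "S = fibre X v"
  have fin: "finite S" using finite_fibre[OF dX] by (simp add: S_def)
  have "card S > 0"
    using card_fibre_add_ram[OF dX, of v] sum_ram_le[OF dX, of "{v}"] dX by (simp add: S_def)
  have pull: "fibre B s \<subseteq> S" if "s \<in> S" for s
  proof
    fix z assume "z \<in> fibre B s"
    then have "poly A (poly X z) = v"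
      using arg_cong[OF eq, of "\<lambda>p. poly p z"] that by (simp add: poly_pcompose fibre_def S_def)
    then have "poly X z \<in> fibre A v" by (simp add: fibre_def)
    with v show "z \<in> S" by (simp add: S_def fibre_def)
  qed
  have "(\<Sum>s\<in>S. card (fibre B s)) = card (\<Union>s\<in>S. fibre B s)"
    by (rule card_UN_disjoint[symmetric]) (use fin finite_fibre[OF dB'] in \<open>auto simp: fibre_def\<close>)
  also have "\<dots> \<le> card S" using pull fin by (intro card_mono) auto
  finally have le: "(\<Sum>s\<in>S. card (fibre B s)) \<le> card S" .
  have "card S * degree B = (\<Sum>s\<in>S. card (fibre B s) + ram B s)"
    using card_fibre_add_ram[OF dB'] by simp
  also have "\<dots> \<le> card S + (degree B - 1)"
    using le sum_ram_le[OF dB' fin] by (simp add: sum.distrib)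
  finally have ineq: "card S * degree B \<le> card S + (degree B - 1)" .
  have "card S = 1"
  proof (rule ccontr)
    assume "card S \<noteq> 1"
    with \<open>card S > 0\<close> have "2 \<le> card S" by simp
    then obtain k where k: "card S = k + 2" by (metis le_add_diff_inverse2)
    obtain j where j: "degree B = j + 2" using dB by (metis le_add_diff_inverse2)
    from ineq show False by (simp add: k j algebra_simps)
  qed
  then obtain s where s: "S = {s}" by (rule card_1_singletonE)
  have "card (fibre B s) > 0"
    using card_fibre_add_ram[OF dB', of s] sum_ram_le[OF dB', of "{s}"] dB by simp
  then have "fibre B s \<noteq> {}" by auto
  with pull[of s] s show ?thesis by auto
qed

lemma totally_invariant_normal_form:
  fixes A :: "complex poly"
  assumes "degree A > 0" "fibre A v = {v}"
  shows "\<exists>c. c \<noteq> 0 \<and> A = [:v:] + smult c ([:-v, 1:] ^ degree A)"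
proof -
  let ?P = "A - [:v:]"
  have nz: "?P \<noteq> 0" using minus_const_nonzero[OF assms(1)] .
  have "smult (lead_coeff ?P) (\<Prod>z\<in>fibre A v. [:-z, 1:] ^ order z ?P) = ?P"
    unfolding fibre_eq_roots by (rule complex_poly_decompose)
  then have P: "smult (lead_coeff ?P) ([:-v, 1:] ^ order v ?P) = ?P"
    unfolding assms(2) by (simp only: finite.emptyI prod.insert prod.empty empty_iff not_False_eq_True mult_1_right)
  have lc: "lead_coeff ?P \<noteq> 0" using nz by (simp only: leading_coeff_0_iff not_False_eq_True)
  have "degree A = degree (smult (lead_coeff ?P) ([:-v, 1:] ^ order v ?P))"
    unfolding P by (simp only: degree_minus_const)
  also have "\<dots> = order v ?P"
    using lc by (simp only: degree_smult_eq degree_linear_power if_False)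
  finally have "?P = smult (lead_coeff ?P) ([:-v, 1:] ^ degree A)" using P by simp
  then have "A = [:v:] + smult (lead_coeff ?P) ([:-v, 1:] ^ degree A)"
    by (simp only: diff_eq_eq add.commute)
  with lc show ?thesis by blast
qed

text \<open>Both maps are power maps, centred at \<open>v\<close> and \<open>s\<close>.  A linear map taking \<open>s\<close> to \<open>v\<close> with suitable
  slope adjusts the leading coefficient.\<close>

lemma totally_invariant_imp_swap:
  fixes A B :: "complex poly"
  assumes "degree A \<ge> 2" "degree B = degree A" "fibre A v = {v}" "fibre B s = {s}"
  shows "swap A B"
proof -
  define m where "m = degree A"
  obtain c where c: "c \<noteq> 0" "A = [:v:] + smult c ([:-v, 1:] ^ m)"
    using totally_invariant_normal_form[of A v] assms by (auto simp: m_def)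
  obtain d where d: "d \<noteq> 0" "B = [:s:] + smult d ([:-s, 1:] ^ m)"
    using totally_invariant_normal_form[of B s] assms by (auto simp: m_def)
  have "m - 1 > 0" using assms by (simp add: m_def)
  \<comment> \<open>The slope \<open>k\<close> of a linear conjugation must satisfy \<open>c k\<^bsup>m\<^esup> = k d\<close>.\<close>
  then obtain k where k: "k ^ (m - 1) = d / c" using nth_root_exists by blast
  then have "k \<noteq> 0" using c d \<open>m - 1 > 0\<close> by (auto simp: power_0_left)
  have km: "c * k ^ m = k * d"
    using k c(1) \<open>m - 1 > 0\<close> by (cases m) (auto simp: field_simps)
  define L where "L = [:v - k * s, k:]"
  have pw: "(P ^ i) \<circ>\<^sub>p Q = (P \<circ>\<^sub>p Q) ^ i" for P Q :: "complex poly" and i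
    by (induction i) (simp_all add: pcompose_mult pcompose_1)
  have L: "L = [:v:] + smult k [:-s, 1:]" by (simp add: L_def algebra_simps)
  have "A \<circ>\<^sub>p L = [:v:] + smult c ((smult k [:-s, 1:]) ^ m)"
  proof -
    have "[:-v, 1:] \<circ>\<^sub>p L = smult k [:-s, 1:]" by (simp add: L_def pcompose_pCons)
    then show ?thesis by (simp add: c(2) pcompose_add pcompose_smult pw)
  qed
  also have "\<dots> = [:v:] + smult (k * d) ([:-s, 1:] ^ m)"
    by (simp only: smult_power smult_smult km)
  also have "\<dots> = L \<circ>\<^sub>p B"
    by (simp add: L_def pcompose_pCons d(2) algebra_simps smult_add_right)
  finally have "A \<circ>\<^sub>p L = L \<circ>\<^sub>p B" .
  moreover have "degree L = 1" using \<open>k \<noteq> 0\<close> by (simp add: L_def)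
  ultimately show ?thesis by (intro linear_conjugate_imp_swap)
qed

section \<open>Chebyshev polynomials\<close>

lemma dvd_if_order_le:
  fixes P Q :: "complex poly"
  assumes "P \<noteq> 0" "Q \<noteq> 0" "\<And>z. order z P \<le> order z Q"
  shows "P dvd Q"
proof -
  have "proots P \<subseteq># proots Q"
    using assms by (intro mset_subset_eqI) auto
  then have "(\<Prod>x\<in>#proots P. [:-x, 1:]) dvd (\<Prod>x\<in>#proots Q. [:-x, 1:])"
    by (intro prod_mset_subset_imp_dvd image_mset_subseteq_mono)
  then have "smult (lead_coeff P) (\<Prod>x\<in>#proots P. [:-x, 1:]) dvd
      smult (lead_coeff Q) (\<Prod>x\<in>#proots Q. [:-x, 1:])"
    using assms(1,2) by (intro smult_dvd) (auto intro: dvd_smult)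
  then show ?thesis by (simp only: complex_poly_decompose_multiset)
qed

text \<open>Compare the zeros of the two sides.  Over \<open>u\<close> and \<open>v\<close>, a simple point is itself \<open>u\<close> or \<open>v\<close>,
  and is a zero of the factor \<open>(z - u) (z - v)\<close>; a point of index \<open>e \<ge> 2\<close> is a zero of order
  \<open>2 (e - 1) \<ge> e\<close> of the squared derivative.  So the left side divides the right side, and the degrees
  agree.\<close>

lemma chebyshev_equation_of_simple_points:
  fixes A :: "complex poly"
  assumes deg: "degree A > 0" and "u \<noteq> v"
    and simple: "simple_points A u \<subseteq> {u, v}" "simple_points A v \<subseteq> {u, v}"
  shows "smult (of_nat (degree A) ^ 2) ((A - [:u:]) * (A - [:v:])) =
    [:-u, 1:] * [:-v, 1:] * pderiv A ^ 2"
proof -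
  define m where "m = degree A"
  define P where "P = (A - [:u:]) * (A - [:v:])"
  define W where "W = [:-u, 1:] * [:-v, 1:]"
  have W: "W \<noteq> 0" "degree W = 2" "lead_coeff W = 1" "poly W u = 0" "poly W v = 0"
    by (auto simp: W_def)
  define Q where "Q = W * pderiv A ^ 2"
  have nz: "A - [:u:] \<noteq> 0" "A - [:v:] \<noteq> 0" "pderiv A \<noteq> 0"
    using deg by (auto simp: minus_const_nonzero pderiv_nonzero)
  then have "P \<noteq> 0" "Q \<noteq> 0" using W(1) by (auto simp: P_def Q_def)
  have ordQ: "order z Q = order z W + 2 * order z (pderiv A)" for z
  proof -
    have "order z Q = order z W + order z (pderiv A ^ 2)"
      unfolding Q_def by (rule order_mult) (use \<open>Q \<noteq> 0\<close> in \<open>simp add: Q_def\<close>)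
    also have "order z (pderiv A ^ 2) = 2 * order z (pderiv A)"
      using nz(3) by (simp add: power2_eq_square order_mult)
    finally show ?thesis .
  qed
  have key: "Suc (order z (pderiv A)) \<le> order z Q"
    if "poly (pderiv A) z = 0 \<or> z \<in> {u, v}" for z
  proof (cases "poly (pderiv A) z = 0")
    case True
    then have "order z (pderiv A) > 0" using nz(3) by (simp add: order_gt_0_iff)
    then show ?thesis by (simp add: ordQ)
  next
    case False
    then have "order z (pderiv A) = 0" by (rule order_0I)
    moreover have "poly Q z = 0" using that False W(4,5) by (auto simp: Q_def)
    then have "order z Q > 0" using \<open>Q \<noteq> 0\<close> by (simp add: order_gt_0_iff)
    ultimately show ?thesis by simp
  qed
  have "order z P \<le> order z Q" for z
  proof -
    have ordP: "order z P = order z (A - [:u:]) + order z (A - [:v:])"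
      unfolding P_def by (rule order_mult) (use \<open>P \<noteq> 0\<close> in \<open>simp add: P_def\<close>)
    consider (1) "poly A z = u" | (2) "poly A z = v" | (3) "poly A z \<noteq> u" "poly A z \<noteq> v" by blast
    then show ?thesis
    proof cases
      case 1
      have "order z (A - [:v:]) = 0" by (rule order_0I) (use 1 assms(2) in simp)
      moreover have "poly (pderiv A) z = 0 \<or> z \<in> {u, v}"
        using 1 simple(1) by (auto simp: simple_points_def)
      ultimately show ?thesis
        using key order_minus_const[OF deg 1] by (simp add: ordP)
    next
      case 2
      have "order z (A - [:u:]) = 0" by (rule order_0I) (use 2 assms(2) in simp)
      moreover have "poly (pderiv A) z = 0 \<or> z \<in> {u, v}"
        using 2 simple(2) by (auto simp: simple_points_def)
      ultimately show ?thesis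
        using key order_minus_const[OF deg 2] by (simp add: ordP)
    next
      case 3
      then have "order z (A - [:u:]) = 0" "order z (A - [:v:]) = 0" by (auto intro!: order_0I)
      then show ?thesis by (simp add: ordP)
    qed
  qed
  then have "P dvd Q" by (rule dvd_if_order_le[OF \<open>P \<noteq> 0\<close> \<open>Q \<noteq> 0\<close>])
  then obtain R where R: "Q = P * R" by (elim dvdE)
  have "R \<noteq> 0" using R \<open>Q \<noteq> 0\<close> by auto
  have degP: "degree P = 2 * m"
    using nz by (simp add: P_def degree_mult_eq degree_minus_const m_def)
  have "degree Q = 2 + 2 * (m - 1)"
    using nz W(1,2) by (simp add: Q_def degree_mult_eq degree_power_eq degree_pderiv m_def)
  with deg have "degree Q = 2 * m" by (simp add: m_def)
  with R degP \<open>P \<noteq> 0\<close> \<open>R \<noteq> 0\<close> have "degree R = 0" by (simp add: degree_mult_eq)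
  then obtain c where c: "R = [:c:]" by (metis degree_eq_zeroE)
  have lc: "lead_coeff (A - [:w:]) = lead_coeff A" for w
    using deg by (simp add: degree_minus_const coeff_eq_0)
  have "lead_coeff P = lead_coeff A ^ 2"
    by (simp only: P_def lead_coeff_mult lc power2_eq_square)
  moreover have "lead_coeff (pderiv A) = of_nat m * lead_coeff A"
    using deg by (simp add: degree_pderiv coeff_pderiv m_def)
  then have "lead_coeff Q = of_nat m ^ 2 * lead_coeff A ^ 2"
    by (simp only: Q_def lead_coeff_mult lead_coeff_power power_mult_distrib W(3) mult_1)
  moreover have "lead_coeff Q = lead_coeff P * c" by (simp add: R c lead_coeff_mult)
  moreover have "lead_coeff A \<noteq> 0" using deg by auto
  ultimately have "c = of_nat m ^ 2" by simp
  then have "smult (of_nat m ^ 2) P = Q" by (simp add: R c)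
  then show ?thesis by (simp only: P_def Q_def W_def m_def)
qed

text \<open>The differential equation \<open>m\<^sup>2 (A\<^sup>2 - 1) = (z\<^sup>2 - 1) A'\<^sup>2\<close> with \<open>m = deg A\<close>; its nonconstant
  solutions are, up to sign, the Chebyshev polynomials of the first kind.\<close>

definition chebyshev :: "complex poly \<Rightarrow> bool" where
  "chebyshev A \<longleftrightarrow> smult (of_nat (degree A) ^ 2) (A ^ 2 - 1) = [:-1, 0, 1:] * pderiv A ^ 2"

lemma smult_left_cancel: "a \<noteq> 0 \<Longrightarrow> smult a p = smult a q \<Longrightarrow> p = (q :: complex poly)"
  using smult_eq_0_iff[of a "p - q"] by (simp add: smult_diff_right)

lemma chebyshev_normalization:
  fixes A :: "complex poly"
  assumes deg: "degree A > 0" and "u \<noteq> v"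
    and eq: "smult (of_nat (degree A) ^ 2) ((A - [:u:]) * (A - [:v:])) =
      [:-u, 1:] * [:-v, 1:] * pderiv A ^ 2"
  shows "\<exists>A'. swap A A' \<and> chebyshev A'"
proof -
  define k where "k = (u - v) / 2"
  \<comment> \<open>\<open>L\<close> maps \<open>1\<close> to \<open>u\<close> and \<open>-1\<close> to \<open>v\<close>.\<close>
  define L where "L = [:(u + v) / 2, k:]"
  have "k \<noteq> 0" using assms(2) by (simp add: k_def)
  then have L1: "degree L = 1" by (simp add: L_def)
  obtain M where M: "degree M = 1" "L \<circ>\<^sub>p M = [:0, 1:]" "M \<circ>\<^sub>p L = [:0, 1:]"
    by (rule linear_poly_inverse[OF L1])
  define A' where "A' = M \<circ>\<^sub>p (A \<circ>\<^sub>p L)"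
  have AL: "A \<circ>\<^sub>p L = L \<circ>\<^sub>p A'"
    by (simp add: A'_def pcompose_assoc M(2) pcompose_pCons)
  have dA': "degree A' = degree A" by (simp add: A'_def degree_pcompose M(1) L1)
  have LA: "A \<circ>\<^sub>p L = [:(u + v) / 2:] + smult k A'"
    unfolding AL by (simp add: L_def pcompose_pCons)
  have d: "pderiv A \<circ>\<^sub>p L = pderiv A'"
  proof -
    have "smult k (pderiv A \<circ>\<^sub>p L) = smult k (pderiv A')"
      using arg_cong[OF LA, of pderiv]
      by (simp add: pderiv_pcompose L_def pderiv_pCons pderiv_add pderiv_smult mult.commute)
    with \<open>k \<noteq> 0\<close> show ?thesis by (rule smult_left_cancel)
  qed
  have lin: "[:(u + v) / 2:] + smult k P - [:u:] = smult k (P - 1)"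
    "[:(u + v) / 2:] + smult k P - [:v:] = smult k (P + 1)" for P
  proof -
    have "[:(u + v) / 2:] = [:u:] - [:k:]" "[:(u + v) / 2:] = [:v:] + [:k:]"
      by (simp_all add: k_def field_simps)
    moreover have "smult k 1 = [:k:]" by simp
    ultimately show "[:(u + v) / 2:] + smult k P - [:u:] = smult k (P - 1)"
      "[:(u + v) / 2:] + smult k P - [:v:] = smult k (P + 1)"
      by (simp_all only: smult_diff_right smult_add_right) simp_all
  qed
  have Lx: "L = [:(u + v) / 2:] + smult k [:0, 1:]" by (simp add: L_def)
  have shift: "L - [:u:] = smult k ([:0, 1:] - 1)" "L - [:v:] = smult k ([:0, 1:] + 1)"
    unfolding Lx by (rule lin)+
  have shift': "A \<circ>\<^sub>p L - [:u:] = smult k (A' - 1)" "A \<circ>\<^sub>p L - [:v:] = smult k (A' + 1)"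
    unfolding LA by (rule lin)+
  have mono: "[:-w, 1:] \<circ>\<^sub>p L = L - [:w:]" for w by (simp add: pcompose_pCons)
  have "smult (of_nat (degree A) ^ 2) ((A \<circ>\<^sub>p L - [:u:]) * (A \<circ>\<^sub>p L - [:v:])) =
      (L - [:u:]) * (L - [:v:]) * (pderiv A \<circ>\<^sub>p L) ^ 2"
    using arg_cong[OF eq, of "\<lambda>p. p \<circ>\<^sub>p L"]
    by (simp only: pcompose_smult pcompose_mult pcompose_diff pcompose_const mono power2_eq_square)
  then have "smult (of_nat (degree A) ^ 2) (smult k (A' - 1) * smult k (A' + 1)) =
      smult k ([:0, 1:] - 1) * smult k ([:0, 1:] + 1) * pderiv A' ^ 2"
    unfolding shift shift' d .
  then have "smult (k * k) (smult (of_nat (degree A) ^ 2) ((A' - 1) * (A' + 1))) =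
      smult (k * k) (([:0, 1:] - 1) * ([:0, 1:] + 1) * pderiv A' ^ 2)"
    by (simp only: mult_smult_left mult_smult_right smult_smult ac_simps)
  then have "smult (of_nat (degree A) ^ 2) ((A' - 1) * (A' + 1)) =
      ([:0, 1:] - 1) * ([:0, 1:] + 1) * pderiv A' ^ 2"
    by (rule smult_left_cancel[rotated]) (use \<open>k \<noteq> 0\<close> in simp)
  moreover have "(A' - 1) * (A' + 1) = A' ^ 2 - 1"
    by (simp add: power2_eq_square algebra_simps)
  moreover have "([:0, 1:] - 1) * ([:0, 1:] + 1) = [:-1, 0, 1 :: complex:]"
    by (simp add: one_pCons)
  ultimately have "chebyshev A'" unfolding chebyshev_def dA' by simp
  moreover have "swap A A'" using linear_conjugate_imp_swap[OF L1 AL] .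
  ultimately show ?thesis by blast
qed

text \<open>The linear equation \<open>m\<^sup>2 p = z p' + (z\<^sup>2 - 1) p''\<close>, which results from \<open>chebyshev\<close> by
  differentiation and division by \<open>2 p'\<close>.  Linearity makes solutions comparable.\<close>

definition chebyshev_ode :: "nat \<Rightarrow> complex poly \<Rightarrow> bool" where
  "chebyshev_ode m p \<longleftrightarrow>
    smult (of_nat m ^ 2) p = [:0, 1:] * pderiv p + [:-1, 0, 1:] * pderiv (pderiv p)"

lemma chebyshev_imp_ode:
  assumes "chebyshev A" "degree A > 0"
  shows "chebyshev_ode (degree A) A"
proof -
  let ?m = "of_nat (degree A) ^ 2 :: complex"
  define x W :: "complex poly" where xW: "x = [:0, 1:]" "W = [:-1, 0, 1:]"
  have two: "smult 2 p = p + p" for p :: "complex poly" using smult_add_left[of 1 1 p] by simp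
  have W: "pderiv W = x + x" by (simp add: xW pderiv_pCons)
  have "pderiv (smult ?m (A ^ 2 - 1)) = pderiv (W * pderiv A ^ 2)"
    using assms(1) by (simp only: chebyshev_def xW)
  then have "smult ?m (A * pderiv A + pderiv A * A) =
      W * (pderiv A * pderiv (pderiv A) + pderiv (pderiv A) * pderiv A) + (x + x) * pderiv A ^ 2"
    by (simp only: pderiv_smult pderiv_diff pderiv_mult pderiv_1 W power2_eq_square diff_zero ac_simps)
  moreover have "smult 2 (pderiv A) * smult ?m A = smult ?m (A * pderiv A + pderiv A * A)"
    by (simp only: two distrib_left distrib_right mult_smult_left mult_smult_right smult_add_right ac_simps)
  moreover have "smult 2 (pderiv A) * (x * pderiv A + W * pderiv (pderiv A)) =
      W * (pderiv A * pderiv (pderiv A) + pderiv (pderiv A) * pderiv A) + (x + x) * pderiv A ^ 2"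
    by (simp only: two power2_eq_square distrib_left distrib_right ac_simps)
  ultimately have eq: "smult 2 (pderiv A) * smult ?m A =
      smult 2 (pderiv A) * (x * pderiv A + W * pderiv (pderiv A))" by (simp only:)
  have "smult 2 (pderiv A) \<noteq> 0" using pderiv_nonzero[OF assms(2)] by simp
  from mult_left_cancel[OF this, THEN iffD1, OF eq]
  show ?thesis by (simp only: chebyshev_ode_def xW)
qed

lemma coeff_chebyshev_ode:
  assumes "chebyshev_ode m p"
  shows "(of_nat m ^ 2 - of_nat k ^ 2) * coeff p k = - of_nat ((k + 1) * (k + 2)) * coeff p (k + 2)"
proof -
  have shift: "[:-1, 0, 1:] * q = pCons 0 (pCons 0 q) - q" for q :: "complex poly"
    by simp
  have 1: "coeff (pCons 0 (pderiv p)) k = of_nat k * coeff p k"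
    by (cases k) (simp_all add: coeff_pderiv)
  have 2: "coeff (pCons 0 (pCons 0 (pderiv (pderiv p)))) k = of_nat k * (of_nat (k - 1) * coeff p k)"
  proof (cases k)
    case (Suc i)
    then show ?thesis by (cases i) (simp_all add: coeff_pderiv mult.left_commute)
  qed simp
  have 3: "coeff (pderiv (pderiv p)) k = of_nat ((k + 1) * (k + 2)) * coeff p (k + 2)"
    by (simp add: coeff_pderiv algebra_simps)
  have 4: "of_nat k ^ 2 = of_nat k + of_nat k * (of_nat (k - 1) :: complex)"
    by (cases k) (simp_all add: power2_eq_square algebra_simps)
  have "smult (of_nat m ^ 2) p =
      pCons 0 (pderiv p) + (pCons 0 (pCons 0 (pderiv (pderiv p))) - pderiv (pderiv p))"
    using assms unfolding chebyshev_ode_def shift by simp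
  then have "of_nat m ^ 2 * coeff p k = coeff (pCons 0 (pderiv p)) k +
      (coeff (pCons 0 (pCons 0 (pderiv (pderiv p)))) k - coeff (pderiv (pderiv p)) k)"
    by (metis coeff_add coeff_diff coeff_smult)
  then show ?thesis
    unfolding 1 2 3 4 by algebra
qed

text \<open>In degree \<open>k = deg p < m\<close> the equation compares \<open>m\<^sup>2\<close> with \<open>k\<^sup>2\<close> times the leading coefficient of \<open>p\<close>.\<close>

lemma chebyshev_ode_unique:
  assumes "chebyshev_ode m p" "\<And>k. k \<ge> m \<Longrightarrow> coeff p k = 0"
  shows "p = 0"
proof (rule ccontr)
  assume "p \<noteq> 0"
  define k where "k = degree p"
  have lc: "coeff p k \<noteq> 0" using \<open>p \<noteq> 0\<close> by (simp add: k_def)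
  then have "k < m" using assms(2) by (meson not_le)
  have "coeff p (k + 2) = 0" by (simp add: k_def coeff_eq_0)
  with coeff_chebyshev_ode[OF assms(1), of k] lc have "of_nat m ^ 2 = (of_nat k ^ 2 :: complex)" by simp
  then have "m ^ 2 = k ^ 2" by (metis of_nat_eq_iff of_nat_power)
  with \<open>k < m\<close> show False by simp
qed

lemma chebyshev_ode_lincomb:
  assumes "chebyshev_ode m p" "chebyshev_ode m q"
  shows "chebyshev_ode m (smult a p - smult b q)"
proof -
  let ?m = "of_nat m ^ 2 :: complex"
  define x W :: "complex poly" where xW: "x = [:0, 1:]" "W = [:-1, 0, 1:]"
  have "smult ?m (smult a p - smult b q) = smult a (smult ?m p) - smult b (smult ?m q)"
    by (simp add: smult_diff_right mult.commute)
  also have "\<dots> = smult a (x * pderiv p + W * pderiv (pderiv p)) - smult b (x * pderiv q + W * pderiv (pderiv q))"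
    using assms by (simp only: chebyshev_ode_def xW)
  also have "\<dots> = x * pderiv (smult a p - smult b q) + W * pderiv (pderiv (smult a p - smult b q))"
    by (simp add: pderiv_diff pderiv_smult smult_add_right right_diff_distrib)
  finally show ?thesis unfolding chebyshev_ode_def xW .
qed

lemma chebyshev_endpoint: "chebyshev A \<Longrightarrow> degree A > 0 \<Longrightarrow> e ^ 2 = 1 \<Longrightarrow> poly A e ^ 2 = 1"
proof -
  assume A: "chebyshev A" "degree A > 0" and e: "e ^ 2 = 1"
  have "poly [:-1, 0, 1:] e = 0" using e by (simp add: power2_eq_square)
  then have "of_nat (degree A) ^ 2 * (poly A e ^ 2 - 1) = 0"
    using arg_cong[OF A(1)[unfolded chebyshev_def], of "\<lambda>p. poly p e"]
    by (simp only: poly_smult poly_mult poly_diff poly_power poly_1 mult_zero_left)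
  with A(2) show ?thesis by simp
qed

text \<open>The linear equation fixes a solution up to a scalar, and the scalar squares to one because both
  polynomials take values \<open>\<plusminus>1\<close> at the point \<open>1\<close>.\<close>

lemma chebyshev_unique_up_to_sign:
  assumes "chebyshev A" "chebyshev B" "degree A = degree B" "degree A > 0"
  shows "B = A \<or> B = -A"
proof -
  define m where "m = degree A"
  have ode: "chebyshev_ode m A" "chebyshev_ode m B"
    using chebyshev_imp_ode[OF assms(1,4)] chebyshev_imp_ode[OF assms(2)] assms(3,4)
    by (simp_all add: m_def)
  have "smult (lead_coeff B) A - smult (lead_coeff A) B = 0"
  proof (rule chebyshev_ode_unique[OF chebyshev_ode_lincomb[OF ode]])
    show "coeff (smult (lead_coeff B) A - smult (lead_coeff A) B) k = 0" if "k \<ge> m" for k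
      using that assms(3) by (cases "k = m") (auto simp: m_def coeff_eq_0)
  qed
  then have proportional: "smult (lead_coeff B) A = smult (lead_coeff A) B" by simp
  define c where "c = lead_coeff B / lead_coeff A"
  have "lead_coeff A \<noteq> 0" using assms(4) by auto
  then have B: "B = smult c A"
    using arg_cong[OF proportional, of "smult (1 / lead_coeff A)"] by (simp add: c_def)
  have "poly A 1 ^ 2 = 1" "poly B 1 ^ 2 = 1"
    using chebyshev_endpoint assms by auto
  then have "c ^ 2 = 1" by (simp add: B power_mult_distrib)
  then have "c = 1 \<or> c = -1" by (simp add: power2_eq_1_iff)
  with B show ?thesis by auto
qed

lemma chebyshev_parity:
  assumes "chebyshev A" "degree A > 0"
  shows "A \<circ>\<^sub>p [:0, -1:] = smult ((-1) ^ degree A) A"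
proof -
  have ode: "chebyshev_ode (degree A) A" using assms by (rule chebyshev_imp_ode)
  have "pderiv (A \<circ>\<^sub>p [:0, -1:]) = - (pderiv A \<circ>\<^sub>p [:0, -1:])"
    "pderiv (pderiv (A \<circ>\<^sub>p [:0, -1:])) = pderiv (pderiv A) \<circ>\<^sub>p [:0, -1:]"
    by (simp_all add: pderiv_pcompose pderiv_pCons pderiv_minus)
  moreover have "[:0, 1:] \<circ>\<^sub>p [:0, -1:] = - [:0, 1 :: complex:]"
    "[:-1, 0, 1:] \<circ>\<^sub>p [:0, -1:] = [:-1, 0, 1 :: complex:]"
    by (simp_all add: pcompose_pCons)
  ultimately have "chebyshev_ode (degree A) (A \<circ>\<^sub>p [:0, -1:])"
    using arg_cong[OF ode[unfolded chebyshev_ode_def], of "\<lambda>p. p \<circ>\<^sub>p [:0, -1:]"]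
    by (simp only: chebyshev_ode_def pcompose_smult pcompose_add pcompose_mult minus_mult_commute)
  from chebyshev_ode_lincomb[OF this ode, of 1 "(-1) ^ degree A"]
  have "smult 1 (A \<circ>\<^sub>p [:0, -1:]) - smult ((-1) ^ degree A) A = 0"
  proof (rule chebyshev_ode_unique)
    show "coeff (smult 1 (A \<circ>\<^sub>p [:0, -1:]) - smult ((-1) ^ degree A) A) k = 0" if "k \<ge> degree A" for k
      using that by (cases "k = degree A") (auto simp: coeff_pcompose_linear coeff_eq_0)
  qed
  then show ?thesis by simp
qed

lemma order_pcompose:
  fixes G T :: "complex poly"
  assumes "G \<noteq> 0" "degree T > 0"
  shows "order y (G \<circ>\<^sub>p T) = order (poly T y) G * Suc (order y (pderiv T))"
proof -
  define w where "w = poly T y"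
  define k where "k = order w G"
  obtain H where H: "G = [:-w, 1:] ^ k * H" "\<not> [:-w, 1:] dvd H"
    using order_decomp[OF assms(1), of w] by (auto simp: k_def)
  have "poly H w \<noteq> 0" using H(2) by (simp add: poly_eq_0_iff_dvd)
  have pw: "(P ^ i) \<circ>\<^sub>p Q = (P \<circ>\<^sub>p Q) ^ i" for P Q :: "complex poly" and i
    by (induction i) (simp_all add: pcompose_mult pcompose_1)
  have lin: "[:-w, 1:] \<circ>\<^sub>p T = T - [:w:]" by (simp add: pcompose_pCons)
  have nz: "T - [:w:] \<noteq> 0" using minus_const_nonzero[OF assms(2)] .
  have "H \<noteq> 0" using H(1) assms(1) by auto
  then have "H \<circ>\<^sub>p T \<noteq> 0" using assms(2) by (simp add: pcompose_eq_0_iff)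
  have op: "order y (P ^ i) = i * order y P" if "P \<noteq> 0" for P :: "complex poly" and i
    using that by (induction i) (simp_all add: order_mult)
  have "order y (G \<circ>\<^sub>p T) = order y ((T - [:w:]) ^ k * (H \<circ>\<^sub>p T))"
    by (subst H(1)) (simp only: pcompose_mult pw lin)
  also have "\<dots> = order y ((T - [:w:]) ^ k) + order y (H \<circ>\<^sub>p T)"
    using nz \<open>H \<circ>\<^sub>p T \<noteq> 0\<close> by (intro order_mult) (simp only: mult_eq_0_iff power_eq_0_iff simp_thms)
  also have "order y (H \<circ>\<^sub>p T) = 0"
    using \<open>poly H w \<noteq> 0\<close> by (intro order_0I) (simp add: poly_pcompose w_def)
  also have "order y ((T - [:w:]) ^ k) = k * Suc (order y (pderiv T))"
    using op[OF nz] order_minus_const[OF assms(2) w_def[symmetric]] by simp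
  finally show ?thesis by (simp add: k_def w_def)
qed

lemma square_of_even_orders:
  fixes G :: "complex poly"
  assumes "\<And>z. even (order z G)"
  shows "\<exists>R. G = R ^ 2"
proof -
  define R where "R = smult (csqrt (lead_coeff G)) (\<Prod>z|poly G z = 0. [:-z, 1:] ^ (order z G div 2))"
  have "R ^ 2 = smult (csqrt (lead_coeff G) ^ 2) ((\<Prod>z|poly G z = 0. [:-z, 1:] ^ (order z G div 2)) ^ 2)"
    unfolding R_def by (rule smult_power)
  also have "(\<Prod>z|poly G z = 0. [:-z, 1:] ^ (order z G div 2)) ^ 2 =
      (\<Prod>z|poly G z = 0. [:-z, 1:] ^ order z G)"
    unfolding prod_power_distrib
    by (rule prod.cong) (use assms in \<open>simp_all add: power_mult[symmetric]\<close>)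
  also have "csqrt (lead_coeff G) ^ 2 = lead_coeff G" by simp
  finally have "R ^ 2 = G" by (simp only: complex_poly_decompose)
  then show ?thesis by metis
qed

text \<open>Otherwise \<open>Y\<^sup>2 - 1 = R\<^sup>2\<close>, and \<open>(Y - R) (Y + R) = 1\<close> makes both factors constant.\<close>

lemma square_minus_one_has_odd_order:
  fixes Y :: "complex poly"
  assumes "degree Y > 0"
  shows "\<exists>z. odd (order z (Y ^ 2 - 1))"
proof (rule ccontr)
  assume "\<not> ?thesis"
  then obtain R where R: "Y ^ 2 - 1 = R ^ 2" using square_of_even_orders by blast
  have one: "(Y - R) * (Y + R) = 1"
  proof -
    have "(Y - R) * (Y + R) = Y ^ 2 - R ^ 2" by (simp add: power2_eq_square algebra_simps)
    also have "\<dots> = 1" by (simp add: R[symmetric])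
    finally show ?thesis .
  qed
  then have "Y - R \<noteq> 0" "Y + R \<noteq> 0" by auto
  then have "degree (Y - R) + degree (Y + R) = degree (1 :: complex poly)"
    using one by (metis degree_mult_eq)
  then have "degree (Y - R) = 0" "degree (Y + R) = 0" by simp_all
  then have "degree ((Y - R) + (Y + R)) = 0"
    using degree_add_le[of "Y - R" 0 "Y + R"] by simp
  moreover have "(Y - R) + (Y + R) = smult 2 Y"
    using smult_add_left[of 1 1 Y] by simp
  ultimately show False using assms by simp
qed

text \<open>Consider \<open>G = Y\<^sup>2 - 1\<close> up to squares.  By the Chebyshev equation \<open>G \<circ> T = (T\<^sup>2 - 1) \<circ> Y\<close> is \<open>G\<close> times a
  square, so the set \<open>S\<close> of zeros of odd order of \<open>G\<close> contains every unramified \<open>T\<close>-preimage of its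
  points.  A point of \<open>S\<close> other than \<open>\<plusminus>1\<close> has \<open>deg T\<close> unramified preimages, and \<open>1\<close>, \<open>-1\<close> are
  fixed, so the finite set \<open>S\<close> would be smaller than a subset of itself unless \<open>S \<subseteq> {1, -1}\<close>.  As \<open>S\<close> is
  not empty, \<open>Y\<close> sends a fixed point of \<open>T\<close> to \<open>\<plusminus>1\<close>; that value is fixed by \<open>T\<close>, but the
  semiconjugacy requires it to be fixed by \<open>-T\<close>.\<close>

lemma no_semiconjugacy_to_negated_chebyshev:
  fixes T Y :: "complex poly"
  assumes T: "chebyshev T" and m: "degree T \<ge> 2" and odd: "odd (degree T)" and T1: "poly T 1 = 1"
    and eq: "(- T) \<circ>\<^sub>p Y = Y \<circ>\<^sub>p T"
  shows "degree Y = 0"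
proof (rule ccontr)
  assume "degree Y \<noteq> 0"
  then have dY: "degree Y > 0" by simp
  have dT: "degree T > 0" using m by simp
  have fixed: "poly T e = e" if "e ^ 2 = 1" for e
  proof -
    have "poly T (-1) = -1"
      using arg_cong[OF chebyshev_parity[OF T dT], of "\<lambda>p. poly p 1"] odd T1
      by (simp add: poly_pcompose)
    moreover have "e = 1 \<or> e = -1" using that by (simp add: power2_eq_1_iff)
    ultimately show ?thesis using T1 by auto
  qed
  define G where "G = Y ^ 2 - 1"
  have "Y \<noteq> 0" using dY by auto
  then have "degree (Y ^ 2) > 0" using dY by (simp add: degree_power_eq)
  then have "G \<noteq> 0" unfolding G_def by (metis degree_1 right_minus_eq less_irrefl)
  define D where "D = pderiv T \<circ>\<^sub>p Y"
  have "D \<noteq> 0" using pderiv_nonzero[OF dT] dY by (simp add: D_def pcompose_eq_0_iff)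
  have sq: "(P ^ 2) \<circ>\<^sub>p Q = (P \<circ>\<^sub>p Q) ^ 2" for P Q :: "complex poly"
    by (simp add: power2_eq_square pcompose_mult)
  have GT: "G \<circ>\<^sub>p T = (T ^ 2 - 1) \<circ>\<^sub>p Y"
  proof -
    have "G \<circ>\<^sub>p T = ((- T) \<circ>\<^sub>p Y) ^ 2 - 1"
      by (simp add: G_def pcompose_diff sq pcompose_1 eq)
    also have "\<dots> = (T ^ 2 - 1) \<circ>\<^sub>p Y"
      by (simp add: pcompose_diff sq pcompose_1 pcompose_uminus)
    finally show ?thesis .
  qed
  have G2: "[:-1, 0, 1:] \<circ>\<^sub>p Y = G"
    by (simp add: G_def pcompose_pCons power2_eq_square one_pCons)
  have "smult (of_nat (degree T) ^ 2) (G \<circ>\<^sub>p T) = G * D ^ 2"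
    using arg_cong[OF T[unfolded chebyshev_def], of "\<lambda>p. p \<circ>\<^sub>p Y"]
    by (simp only: GT pcompose_smult pcompose_mult sq G2 D_def)
  then have "order z (G \<circ>\<^sub>p T) = order z (G * D ^ 2)" for z
    using order_smult[of "of_nat (degree T) ^ 2" z "G \<circ>\<^sub>p T"] dT by simp
  moreover have "order z (G * D ^ 2) = order z G + 2 * order z D" for z
    using \<open>G \<noteq> 0\<close> \<open>D \<noteq> 0\<close> by (simp add: order_mult power2_eq_square)
  ultimately have ord: "order (poly T z) G * Suc (order z (pderiv T)) = order z G + 2 * order z D" for z
    by (simp add: order_pcompose[OF \<open>G \<noteq> 0\<close> dT])
  define S where "S = {z. odd (order z G)}"
  have "S \<subseteq> {z. poly G z = 0}" by (auto simp: S_def order_root \<open>G \<noteq> 0\<close> intro: odd_pos)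
  then have fin: "finite S" using poly_roots_finite[OF \<open>G \<noteq> 0\<close>] finite_subset by blast
  have unram: "ram T w = 0" if "w ^ 2 \<noteq> 1" for w
  proof (rule ccontr)
    assume "ram T w \<noteq> 0"
    then obtain z where z: "poly T z = w" "poly (pderiv T) z = 0"
      using ram_pos_iff[OF dT, of w] by auto
    have "of_nat (degree T) ^ 2 * (w ^ 2 - 1) = 0"
      using arg_cong[OF T[unfolded chebyshev_def], of "\<lambda>p. poly p z"] z
      by (simp only: poly_smult poly_mult poly_diff poly_power poly_1) simp
    with dT that show False by simp
  qed
  \<comment> \<open>The preimages of \<open>w\<close> known to lie in \<open>S\<close>.\<close>
  define F where "F w = (if w ^ 2 = 1 then {w} else fibre T w)" for w
  have F_sub: "F w \<subseteq> S" if w: "w \<in> S" for w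
  proof (cases "w ^ 2 = 1")
    case True
    with w show ?thesis by (simp add: F_def)
  next
    case False
    have "z \<in> S" if z: "z \<in> fibre T w" for z
    proof -
      have "poly (pderiv T) z \<noteq> 0"
        using unram[OF False] ram_pos_iff[OF dT, of w] z by (auto simp: fibre_def)
      then have "order z (pderiv T) = 0" by (rule order_0I)
      then have "order w G = order z G + 2 * order z D" using ord[of z] z by (simp add: fibre_def)
      with w show ?thesis by (simp add: S_def)
    qed
    with False show ?thesis by (auto simp: F_def)
  qed
  have F_fibre: "F w \<subseteq> fibre T w" for w using fixed by (auto simp: F_def fibre_def)
  then have F_point: "poly T z = w" if "z \<in> F w" for z w using that by (auto simp: fibre_def)
  have F_fin: "finite (F w)" for w using F_fibre finite_fibre[OF dT] finite_subset by blast
  have "(\<Sum>w\<in>S. card (F w)) = card (\<Union>w\<in>S. F w)"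
    by (rule card_UN_disjoint[symmetric])
      (use fin F_fin in \<open>auto dest: F_point\<close>)
  also have "\<dots> \<le> card S" by (rule card_mono) (use fin F_sub in auto)
  finally have le: "(\<Sum>w\<in>S. card (F w)) \<le> card S" .
  have card_F: "card (F w) = (if w ^ 2 = 1 then 1 else degree T)" for w
    using card_fibre_add_ram[OF dT, of w] unram[of w] by (cases "w ^ 2 = 1") (simp_all add: F_def)
  have S_ends: "w ^ 2 = 1" if w: "w \<in> S" for w
  proof (rule ccontr)
    assume "w ^ 2 \<noteq> 1"
    then have "1 < card (F w)" using card_F m by simp
    then have "(\<Sum>w\<in>S. 1) < (\<Sum>w\<in>S. card (F w))"
      using card_F m w by (intro sum_strict_mono_ex1 fin) (auto intro!: bexI[of _ w])
    with le show False by simp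
  qed
  obtain w where w: "w \<in> S" using square_minus_one_has_odd_order[OF dY] by (auto simp: S_def G_def)
  then have "poly G w = 0" using \<open>S \<subseteq> {z. poly G z = 0}\<close> by blast
  then have Yw: "poly Y w ^ 2 = 1" by (simp add: G_def)
  have "- poly T (poly Y w) = poly Y (poly T w)"
    using arg_cong[OF eq, of "\<lambda>p. poly p w"] by (simp add: poly_pcompose)
  then have "- poly Y w = poly Y w" using fixed[OF Yw] fixed[OF S_ends[OF w]] by simp
  with Yw show False by simp
qed

text \<open>For odd degree the case \<open>B = -A\<close> is impossible: whichever of \<open>A\<close> and \<open>B\<close> has the value \<open>1\<close> at \<open>1\<close>
  serves as \<open>T\<close>, and each of the two semiconjugacies excludes one possibility.\<close>

lemma chebyshev_imp_swap:
  assumes "chebyshev A" "chebyshev B" "degree A \<ge> 2" "A \<preceq>\<^sub>s B" "B \<preceq>\<^sub>s A"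
  shows "swap A B"
proof -
  have deg: "degree A = degree B" using assms(4) by (rule semiconj_le_degree_eq)
  have dA: "degree A > 0" using assms(3) by simp
  consider (same) "B = A" | (even) "B = -A" "even (degree A)" | (odd) "B = -A" "odd (degree A)"
    using chebyshev_unique_up_to_sign[OF assms(1,2) deg dA] by blast
  then show ?thesis
  proof cases
    case same
    then show ?thesis
      unfolding swap_def by (intro exI[of _ A] exI[of _ "[:0, 1:]"]) (simp add: pcompose_pCons)
  next
    case even
    have "A \<circ>\<^sub>p [:0, -1:] = [:0, -1:] \<circ>\<^sub>p B"
      using chebyshev_parity[OF assms(1) dA] even by (simp add: pcompose_pCons)
    then show ?thesis by (intro linear_conjugate_imp_swap[of "[:0, -1:]"]) simp_all
  next
    case odd
    have "poly A 1 ^ 2 = 1" using chebyshev_endpoint[OF assms(1) dA, of 1] by simp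
    then consider "poly A 1 = 1" | "poly A 1 = -1" by (auto simp: power2_eq_1_iff)
    then show ?thesis
    proof cases
      case 1
      from assms(5) obtain Y where "degree Y > 0" "(-A) \<circ>\<^sub>p Y = Y \<circ>\<^sub>p A"
        by (auto simp: semiconj_le_def odd)
      with no_semiconjugacy_to_negated_chebyshev[OF assms(1,3) odd(2) 1] show ?thesis by simp
    next
      case 2
      then have B1: "poly B 1 = 1" by (simp add: odd)
      from assms(4) obtain X where "degree X > 0" "A \<circ>\<^sub>p X = X \<circ>\<^sub>p B"
        by (auto simp: semiconj_le_def)
      moreover have "A = -B" by (simp add: odd)
      ultimately show ?thesis
        using no_semiconjugacy_to_negated_chebyshev[OF assms(2) _ _ B1, of X] assms(3) odd(2) deg by simp
    qed
  qed
qed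

section \<open>Mutual semiconjugacy\<close>

text \<open>Iterating \<open>P\<close> makes the part of its degree coprime to \<open>deg A\<close> arbitrarily large, and the reduction to
  coprime degrees retains that part.\<close>

lemma commuting_imp_special_representative:
  fixes A P :: "complex poly"
  assumes comm: "A \<circ>\<^sub>p P = P \<circ>\<^sub>p A" and m: "degree A \<ge> 2" and dP: "degree P > 0"
    and r: "r dvd degree P" "coprime r (degree A)" "r \<ge> 2"
  shows "\<exists>A'. swap\<^sup>*\<^sup>* A A' \<and> ((\<exists>v. fibre A' v = {v}) \<or> chebyshev A')"
proof -
  define l where "l = 3 * degree A ^ 2"
  define Q where "Q = poly_iterate P l"
  have comm': "A \<circ>\<^sub>p Q = Q \<circ>\<^sub>p A"
    unfolding Q_def by (rule poly_iterate_intertwine[OF comm[symmetric], symmetric])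
  have dQ: "degree Q = degree P ^ l" by (simp add: Q_def degree_poly_iterate)
  have dA: "degree A > 0" using m by simp
  have "degree Q > 0" using dP dQ by simp
  from strip_to_coprime_degree[OF comm' dA dA this]
  obtain A' Z s where A': "swap\<^sup>*\<^sup>* A A'" "A' \<circ>\<^sub>p Z = Z \<circ>\<^sub>p A" "degree Z > 0"
    "coprime (degree Z) (degree A)" "degree Q = degree Z * s"
    "\<forall>r. coprime r (degree A) \<longrightarrow> coprime r s" by blast
  have deg: "degree A' = degree A" using swap_chain_degree_eq[OF A'(1)] by simp
  have "r ^ l dvd degree Z * s" using r(1) dQ A'(5) by (metis dvd_power_same)
  moreover have "coprime (r ^ l) s" using A'(6) r(2) by simp
  ultimately have "r ^ l dvd degree Z" by (simp add: coprime_dvd_mult_left_iff)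
  then have "r ^ l \<le> degree Z" using A'(3) by (rule dvd_imp_le)
  moreover have "l \<le> r ^ l"
  proof -
    have "l < 2 ^ l" by (rule less_exp)
    also have "2 ^ l \<le> r ^ l" using r(3) by (rule power_mono) simp
    finally show ?thesis by simp
  qed
  ultimately have big: "degree Z \<ge> 3 * degree A' ^ 2" by (simp add: l_def deg)
  have "(\<exists>v. fibre A' v = {v}) \<or>
    (\<exists>u v. u \<noteq> v \<and> simple_points A' u \<subseteq> {u, v} \<and> simple_points A' v \<subseteq> {u, v})"
    by (rule coprime_semiconjugacy_dichotomy[OF A'(2) _ _ _ big]) (use m deg A'(4) in simp_all)
  then show ?thesis
  proof (elim disjE exE conjE)
    fix v assume "fibre A' v = {v}"
    with A'(1) show ?thesis by blast
  next
    fix u v assume uv: "u \<noteq> v" "simple_points A' u \<subseteq> {u, v}" "simple_points A' v \<subseteq> {u, v}"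
    have dA': "degree A' > 0" using dA deg by simp
    obtain A'' where "swap A' A''" "chebyshev A''"
      using chebyshev_normalization[OF dA' uv(1) chebyshev_equation_of_simple_points[OF dA' uv]] by blast
    with A'(1) show ?thesis by (meson rtranclp.rtrancl_into_rtrancl)
  qed
qed

theorem mutual_semiconjugacy_imp_swap_chain:
  fixes A B :: "complex poly"
  assumes m: "degree A \<ge> 2" and AB: "A \<preceq>\<^sub>s B" and BA: "B \<preceq>\<^sub>s A"
  shows "swap\<^sup>*\<^sup>* A B"
proof -
  have deg: "degree B = degree A" using AB by (rule semiconj_le_degree_eq[symmetric])
  obtain X where X: "degree X > 0" "A \<circ>\<^sub>p X = X \<circ>\<^sub>p B" using AB by (auto simp: semiconj_le_def)
  obtain Y where Y: "degree Y > 0" "B \<circ>\<^sub>p Y = Y \<circ>\<^sub>p A" using BA by (auto simp: semiconj_le_def)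
  have dA: "degree A > 0" and dB: "degree B > 0" using m deg by auto
  from strip_to_coprime_degree[OF X(2) dA dB X(1)]
  obtain A0 X0 s where A0: "swap\<^sup>*\<^sup>* A A0" "A0 \<circ>\<^sub>p X0 = X0 \<circ>\<^sub>p B" "degree X0 > 0"
    "coprime (degree X0) (degree A)" "degree X = degree X0 * s" by blast
  show ?thesis
  proof (cases "degree X0 = 1")
    case True
    from linear_conjugate_imp_swap[OF True A0(2)] A0(1) show ?thesis
      by (rule rtranclp.rtrancl_into_rtrancl[rotated])
  next
    case False
    with A0(3) have r: "degree X0 \<ge> 2" by simp
    have "A \<circ>\<^sub>p (X \<circ>\<^sub>p Y) = (X \<circ>\<^sub>p Y) \<circ>\<^sub>p A" by (metis X(2) Y(2) pcompose_assoc)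
    then obtain A' where A': "swap\<^sup>*\<^sup>* A A'" "(\<exists>v. fibre A' v = {v}) \<or> chebyshev A'"
      using commuting_imp_special_representative[of A "X \<circ>\<^sub>p Y" "degree X0"] m X(1) Y(1) A0(4,5) r
      by (auto simp: degree_pcompose)
    have "B \<circ>\<^sub>p (Y \<circ>\<^sub>p X) = (Y \<circ>\<^sub>p X) \<circ>\<^sub>p B" by (metis X(2) Y(2) pcompose_assoc)
    then obtain B' where B': "swap\<^sup>*\<^sup>* B B'" "(\<exists>v. fibre B' v = {v}) \<or> chebyshev B'"
      using commuting_imp_special_representative[of B "Y \<circ>\<^sub>p X" "degree X0"] m X(1) Y(1) A0(4,5) r deg
      by (auto simp: degree_pcompose)
    have degs: "degree A' = degree A" "degree B' = degree A"
      using swap_chain_degree_eq[OF A'(1)] swap_chain_degree_eq[OF B'(1)] deg by simp_all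
    have AA': "A \<preceq>\<^sub>s A'" "A' \<preceq>\<^sub>s A" and BB': "B \<preceq>\<^sub>s B'" "B' \<preceq>\<^sub>s B"
      using swap_chain_imp_semiconj_le[OF A'(1)] swap_chain_imp_semiconj_le[OF B'(1)] degs dA by auto
    have le: "A' \<preceq>\<^sub>s B'" "B' \<preceq>\<^sub>s A'"
      using AA' BB' AB BA semiconj_le_trans by blast+
    have "swap A' B'"
    proof (cases "chebyshev A' \<and> chebyshev B'")
      case True
      then show ?thesis using chebyshev_imp_swap le m degs by simp
    next
      case False
      have transfer: "\<exists>s. fibre Q s = {s}" if "P \<preceq>\<^sub>s Q" "degree Q \<ge> 2" "fibre P v = {v}" for P Q v
        using that totally_invariant_point_transfer unfolding semiconj_le_def by blast
      from False A'(2) B'(2) have "\<exists>v s. fibre A' v = {v} \<and> fibre B' s = {s}"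
        using transfer[OF le(1)] transfer[OF le(2)] m degs by (metis (no_types, lifting))
      then show ?thesis using totally_invariant_imp_swap m degs by auto
    qed
    with A'(1) have "swap\<^sup>*\<^sup>* A B'" by (rule rtranclp.rtrancl_into_rtrancl)
    with swap_chain_sym[OF B'(1)] show ?thesis by (rule rtranclp_trans[rotated])
  qed
qed

theorem theorem1p5:
  fixes A B :: "complex poly"
  assumes "degree A \<ge> 2" and "degree B \<ge> 2"
  shows "(A \<preceq>\<^sub>s B \<and> B \<preceq>\<^sub>s A \<longleftrightarrow> A \<sim>\<^sub>d B) \<and>
         (A \<sim>\<^sub>d B \<longleftrightarrow>
            (\<exists>X Y :: complex poly.
               B \<circ>\<^sub>p Y = Y \<circ>\<^sub>p A \<and> A \<circ>\<^sub>p X = X \<circ>\<^sub>p B \<and>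
               (\<exists>d::nat. Y \<circ>\<^sub>p X = poly_iterate B d)))"
proof -
  have dB: "degree B > 0" using assms(2) by simp
  have 1: "A \<preceq>\<^sub>s B \<and> B \<preceq>\<^sub>s A \<Longrightarrow> A \<sim>\<^sub>d B"
    using mutual_semiconjugacy_imp_swap_chain[OF assms(1)] by (simp add: decomp_equiv_iff_swap_chain)
  have 2: "A \<sim>\<^sub>d B \<Longrightarrow> \<exists>X Y. B \<circ>\<^sub>p Y = Y \<circ>\<^sub>p A \<and> A \<circ>\<^sub>p X = X \<circ>\<^sub>p B \<and> (\<exists>d. Y \<circ>\<^sub>p X = poly_iterate B d)"
    using swap_chain_imp_intertwiners by (auto simp: decomp_equiv_iff_swap_chain)
  have 3: "\<exists>X Y. B \<circ>\<^sub>p Y = Y \<circ>\<^sub>p A \<and> A \<circ>\<^sub>p X = X \<circ>\<^sub>p B \<and> (\<exists>d. Y \<circ>\<^sub>p X = poly_iterate B d) \<Longrightarrow>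
      A \<preceq>\<^sub>s B \<and> B \<preceq>\<^sub>s A"
    using intertwiners_imp_semiconj_le[OF dB] by blast
  from 1 2 3 show ?thesis by blast
qed

end
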